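(* Let $m\ge 1$, $N\ge 0$ and $k\le m$ be integers, and let $S(z)=\sum_{n=-N}^{N} C_n z^n$, with $C_n\in\mathbb{C}^{m\times m}$, be an $m\times m$ (trigonometric) polynomial matrix-function of order $N$ (that is, $C_N=C_{-N}^*\neq \mathbf{0}$) which is nonnegative definite and of rank $k$ for almost all $z\in\mathbb{T}$. Then there exists an $m\times k$ matrix-polynomial $S^+(z)=\sum_{n=0}^{N} A_n z^n$, $A_n\in\mathbb{C}^{m\times k}$, of order $N$ (that is, $A_N\neq\mathbf{0}$), which is of full rank $k$ for each $z$ with $|z|<1$, such that $$S(z)=S^+(z)S^-(z)=\sum_{n=0}^{N}A_nz^n\cdot\sum_{n=0}^{N}A_n^*z^{-n},\qquad z\in\mathbb{C}\setminus\{0\},$$ where $S^-(z)=\sum_{n=0}^{N}A_n^*z^{-n}$. Moreover, $S^+$ is unique up to a constant $k\times k$ unitary matrix right multiplier: if $S_1^+$ is another $m\times k$ matrix-polynomial with these properties, then $S_1^+(z)=S^+(z)U$ for some constant $k\times k$ unitary matrix $U$.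
   Context: $\mathbb{T}=\{z\in\mathbb{C}:|z|=1\}$. For a constant complex matrix $A$, $A^*=\overline{A}^{T}$ is its conjugate transpose. "Almost all $z\in\mathbb{T}$" refers to Lebesgue (arc-length) measure on $\mathbb{T}$. *)

theory Defs
  imports
    "HOL-Analysis.Lebesgue_Measure"
    "Jordan_Normal_Form.DL_Rank"
    "Jordan_Normal_Form.Schur_Decomposition"
begin

text \<open>
  Matrices of unrelated sizes share the type \<^typ>\<open>complex mat\<close>, which therefore has no zero to
  start a sum from: finite sums are formed entrywise and the size is passed explicitly.
\<close>

definition mat_sum :: "nat \<Rightarrow> nat \<Rightarrow> ('i \<Rightarrow> complex mat) \<Rightarrow> 'i set \<Rightarrow> complex mat" where
  "mat_sum nr nc f I = mat nr nc (\<lambda>(i, j). \<Sum>n\<in>I. f n $$ (i, j))"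

definition trig_mat_poly :: "nat \<Rightarrow> nat \<Rightarrow> (int \<Rightarrow> complex mat) \<Rightarrow> complex \<Rightarrow> complex mat" where
  "trig_mat_poly m N C z = mat_sum m m (\<lambda>n. (z powi n) \<cdot>\<^sub>m C n) {- int N..int N}"

definition mat_poly_plus :: "nat \<Rightarrow> nat \<Rightarrow> nat \<Rightarrow> (nat \<Rightarrow> complex mat) \<Rightarrow> complex \<Rightarrow> complex mat" where
  "mat_poly_plus m k N A z = mat_sum m k (\<lambda>n. (z ^ n) \<cdot>\<^sub>m A n) {0..N}"

definition mat_poly_minus :: "nat \<Rightarrow> nat \<Rightarrow> nat \<Rightarrow> (nat \<Rightarrow> complex mat) \<Rightarrow> complex \<Rightarrow> complex mat" where
  "mat_poly_minus m k N A z = mat_sum k m (\<lambda>n. (z powi (- int n)) \<cdot>\<^sub>m mat_adjoint (A n)) {0..N}"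

abbreviation mat_rank :: "nat \<Rightarrow> complex mat \<Rightarrow> nat" where
  "mat_rank nr \<equiv> vec_space.rank nr"

text \<open>
  \<open>(M *\<^sub>v v) \<bullet>c v\<close> is \<open>v\<^sup>* M v\<close>, and \<open>0 \<le> w\<close> for complex \<open>w\<close> says that \<open>w\<close> is real and nonnegative.
\<close>

definition nonneg_definite :: "nat \<Rightarrow> complex mat \<Rightarrow> bool" where
  "nonneg_definite m M \<longleftrightarrow>
     M \<in> carrier_mat m m \<and> mat_adjoint M = M \<and> (\<forall>v\<in>carrier_vec m. 0 \<le> (M *\<^sub>v v) \<bullet>c v)"

definition unitary_mat :: "nat \<Rightarrow> complex mat \<Rightarrow> bool" where
  "unitary_mat k U \<longleftrightarrow>
     U \<in> carrier_mat k k \<and> U * mat_adjoint U = 1\<^sub>m k \<and> mat_adjoint U * U = 1\<^sub>m k"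

definition spectral_factor ::
  "nat \<Rightarrow> nat \<Rightarrow> nat \<Rightarrow> (int \<Rightarrow> complex mat) \<Rightarrow> (nat \<Rightarrow> complex mat) \<Rightarrow> bool" where
  "spectral_factor m k N C A \<longleftrightarrow>
     (\<forall>n\<in>{0..N}. A n \<in> carrier_mat m k) \<and>
     A N \<noteq> 0\<^sub>m m k \<and>
     (\<forall>z. cmod z < 1 \<longrightarrow> mat_rank m (mat_poly_plus m k N A z) = k) \<and>
     (\<forall>z. z \<noteq> 0 \<longrightarrow>
        trig_mat_poly m N C z = mat_poly_plus m k N A z * mat_poly_minus m k N A z)"

end

theory Submission
  imports Defs "HOL-Analysis.Equivalence_Lebesgue_Henstock_Integration" "HOL-Analysis.Function_Topology"
begin

unbundle no vec_syntax

text \<open>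
  Write \<open>S\<^sup>~(z) = S(1 / cnj z)\<^sup>*\<close>, so that the factorization reads \<open>S = A A\<^sup>~\<close> off the origin.

  \<^bold>\<open>Existence.\<close> Finding a factor \<open>A(z) = \<Sum> A\<^sub>n z\<^sup>n\<close>, with any number of columns, amounts to finding a
  positive semidefinite matrix \<open>G\<close> with blocks \<open>G\<^sub>s\<^sub>t = A\<^sub>s A\<^sub>t\<^sup>*\<close> indexed by \<open>s, t \<le> N\<close>, whose blocks
  on the \<open>d\<close>-th diagonal add up to \<open>C\<^sub>d\<close>. These \<open>G\<close> form the set \<open>gram_set\<close>. It is not empty: nonnegativity of \<open>S\<close> on the circle says
  that the large block Toeplitz matrix \<open>(C\<^sub>a\<^sub>-\<^sub>b)\<close> of \<open>n\<close> block rows is positive semidefinite; its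
  Cholesky columns inherit the band width, so each of them, shifted to the origin, fits into \<open>N + 1\<close>
  blocks, and the average of their rank one matrices has diagonal sums \<open>(1 - |d| / n) C\<^sub>d\<close>
  (\<open>ex_averaged_gram\<close>). Compactness lets \<open>n\<close> tend to infinity (\<open>gram_set_nonempty\<close>).

  Among all \<open>G\<close> in this compact set take one for which the trace of the block \<open>G\<^sub>0\<^sub>0 = A\<^sub>0 A\<^sub>0\<^sup>*\<close> is maximal.
  If \<open>h = A u\<close> with \<open>|u| = 1\<close> and \<open>h(a) = 0\<close> with \<open>|a| < 1\<close>, then the zero can be moved out of the disc by a
  Blaschke factor acting on the direction \<open>u\<close>. This does not change \<open>S\<close> and increases the trace, unless
  \<open>h(z) / (z - a)\<close> vanishes at \<open>0\<close>; repeating the argument with \<open>0\<close> in place of \<open>a\<close> shows that every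
  coefficient of \<open>h\<close> is zero (\<open>extremal_gram_no_zero\<close>). As Cholesky columns are linearly independent, this
  is impossible, and \<open>A(z)\<close> is injective throughout the disc. The number of columns must then
  be the rank of \<open>S\<close> at a generic point of the circle, which is \<open>k\<close>.

  \<^bold>\<open>Uniqueness.\<close> If \<open>A A\<^sup>~ = B B\<^sup>~\<close> with both factors injective in the disc, then \<open>A W = d B\<close> for some
  polynomial matrix \<open>W\<close> and scalar polynomial \<open>d \<noteq> 0\<close>; take \<open>d\<close> of least degree. Cancelling \<open>A\<close>
  and \<open>A\<^sup>~\<close> at generic points gives \<open>W W\<^sup>~ = d d\<^sup>~\<close> and \<open>B W\<^sup>~ = d\<^sup>~ A\<close>. At a zero of \<open>d\<close> inside, on or
  outside the circle one of these three identities forces \<open>W\<close> to vanish too, so that a linear factor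
  could be divided out of \<open>W\<close> and \<open>d\<close>. Hence \<open>d\<close> is constant; the same argument at infinity shows that
  \<open>W\<close> is constant, and \<open>W W\<^sup>~ = d d\<^sup>~\<close> makes \<open>W / d\<close> unitary (\<open>unitary_transition\<close>).
\<close>

section \<open>Positive semidefinite forms and their Cholesky factors\<close>

text \<open>
  Indices range over a finite set of an arbitrary type, so that block matrices can be indexed by pairs
  (block, entry) and cut down to sub-blocks without renumbering.
\<close>

definition psd_on :: "'i set \<Rightarrow> ('i \<Rightarrow> 'i \<Rightarrow> complex) \<Rightarrow> bool" where
  "psd_on J T \<longleftrightarrow> (\<forall>x. 0 \<le> (\<Sum>i\<in>J. \<Sum>j\<in>J. cnj (x i) * T i j * x j))"

lemma psd_on_subset:
  assumes "finite J" "psd_on J T" "I \<subseteq> J"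
  shows "psd_on I T"
  unfolding psd_on_def
proof
  fix x :: "_ \<Rightarrow> complex"
  let ?y = "\<lambda>i. if i \<in> I then x i else 0"
  have "0 \<le> (\<Sum>i\<in>J. \<Sum>j\<in>J. cnj (?y i) * T i j * ?y j)"
    using assms(2) unfolding psd_on_def by (rule spec)
  also have "(\<Sum>i\<in>J. \<Sum>j\<in>J. cnj (?y i) * T i j * ?y j) = (\<Sum>i\<in>I. \<Sum>j\<in>J. cnj (?y i) * T i j * ?y j)"
    using assms by (intro sum.mono_neutral_right) auto
  also have "\<dots> = (\<Sum>i\<in>I. \<Sum>j\<in>I. cnj (?y i) * T i j * ?y j)"
    using assms by (intro sum.cong[OF refl] sum.mono_neutral_right) auto
  also have "\<dots> = (\<Sum>i\<in>I. \<Sum>j\<in>I. cnj (x i) * T i j * x j)"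
    by simp
  finally show "0 \<le> (\<Sum>i\<in>I. \<Sum>j\<in>I. cnj (x i) * T i j * x j)" .
qed

lemma psd_on_pair:
  assumes "finite J" "psd_on J T" "i \<in> J" "j \<in> J" "i \<noteq> j"
  shows "0 \<le> cnj \<alpha> * T i i * \<alpha> + cnj \<alpha> * T i j * \<beta> + cnj \<beta> * T j i * \<alpha> + cnj \<beta> * T j j * \<beta>"
proof -
  have "psd_on {i, j} T"
    by (rule psd_on_subset[OF assms(1,2)]) (use assms in auto)
  then have "0 \<le> (\<Sum>k\<in>{i,j}. \<Sum>l\<in>{i,j}. cnj (if k = i then \<alpha> else \<beta>) * T k l * (if l = i then \<alpha> else \<beta>))"
    unfolding psd_on_def by (rule spec)
  then show ?thesis
    using assms(5) by (simp add: add_ac)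
qed

lemma psd_on_diag:
  assumes "finite J" "psd_on J T" "i \<in> J"
  shows "0 \<le> T i i"
proof -
  have "psd_on {i} T"
    by (rule psd_on_subset[OF assms(1,2)]) (use assms in auto)
  then have "0 \<le> (\<Sum>k\<in>{i}. \<Sum>l\<in>{i}. cnj 1 * T k l * 1)"
    unfolding psd_on_def by (rule spec)
  then show ?thesis by simp
qed

text \<open>
  Polarization: a form whose values are all real is Hermitian.
\<close>

lemma psd_on_hermitian:
  assumes "finite J" "psd_on J T" "i \<in> J" "j \<in> J"
  shows "T j i = cnj (T i j)"
proof (cases "i = j")
  case True
  with psd_on_diag[OF assms(1-3)] show ?thesis
    by (simp add: less_eq_complex_def complex_eq_iff)
next
  case False
  note pair = psd_on_pair[OF assms this]
  from pair[of 1 1] psd_on_diag[OF assms(1,2)] assms(3,4) have "Im (T i j) + Im (T j i) = 0"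
    by (simp add: less_eq_complex_def)
  moreover from pair[of 1 \<i>] psd_on_diag[OF assms(1,2)] assms(3,4) have "Re (T i j) - Re (T j i) = 0"
    by (simp add: less_eq_complex_def)
  ultimately show ?thesis by (simp add: complex_eq_iff)
qed

lemma psd_on_zero_diag:
  assumes "finite J" "psd_on J T" "i \<in> J" "j \<in> J" "T i i = 0"
  shows "T i j = 0"
proof (rule ccontr)
  assume nz: "T i j \<noteq> 0"
  then have "i \<noteq> j" using assms(5) by auto
  note pair = psd_on_pair[OF assms(1-4) this]
  \<comment> \<open>makes the form at \<open>- s * T i j\<close>, \<open>1\<close> equal to \<open>- 1\<close>\<close>
  define s where "s = (Re (T j j) + 1) / (2 * (cmod (T i j))\<^sup>2)"
  have "0 \<le> cnj (- s * T i j) * T i j + cnj (T i j) * (- s * T i j) + T j j"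
    using pair[of "- s * T i j" 1] assms(5) psd_on_hermitian[OF assms(1-4)] by (simp add: add.assoc)
  also have "cnj (- s * T i j) * T i j + cnj (T i j) * (- s * T i j) = of_real (- 2 * s * (cmod (T i j))\<^sup>2)"
    unfolding of_real_mult complex_norm_square by simp
  finally have "0 \<le> - 2 * s * (cmod (T i j))\<^sup>2 + Re (T j j)"
    by (simp only: less_eq_complex_def plus_complex.simps Re_complex_of_real) simp
  moreover have "2 * s * (cmod (T i j))\<^sup>2 = Re (T j j) + 1"
    using nz by (simp add: s_def)
  ultimately show False by simp
qed

lemma psd_on_bound:
  assumes "finite J" "psd_on J T" "i \<in> J" "j \<in> J"
  shows "2 * cmod (T i j) \<le> Re (T i i) + Re (T j j)"
proof (cases "i = j \<or> T i j = 0")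
  case True
  with psd_on_diag[OF assms(1,2)] assms(3,4) show ?thesis
    by (auto simp: less_eq_complex_def cmod_def)
next
  case False
  then have ij: "i \<noteq> j" and nz: "T i j \<noteq> 0" by auto
  \<comment> \<open>the phase that turns \<open>T i j\<close> into a negative number\<close>
  define w where "w = - cnj (T i j) / cmod (T i j)"
  have nn: "T i j * cnj (T i j) = of_real (cmod (T i j)) * of_real (cmod (T i j))"
    using complex_norm_square[of "T i j"] unfolding power2_eq_square of_real_mult by (rule sym)
  have w1: "cnj w * w = 1"
    using nz nn by (simp add: w_def)
  have w2: "T i j * w = - cmod (T i j)"
    using nz nn by (simp add: w_def)
  have "0 \<le> T i i + T i j * w + cnj (T i j * w) + (cnj w * w) * T j j"
    using psd_on_pair[OF assms ij, of 1 w] psd_on_hermitian[OF assms] by (simp add: algebra_simps)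
  then show ?thesis unfolding w1 w2 by (simp add: less_eq_complex_def)
qed

lemma psd_on_Schur_complement:
  assumes "finite J" "x \<notin> J" "psd_on (insert x J) T" "T x x \<noteq> 0"
  shows "psd_on J (\<lambda>i j. T i j - T i x * T x j / T x x)"
  unfolding psd_on_def
proof
  fix y :: "_ \<Rightarrow> complex"
  let ?t = "T x x"
  define R where "R = (\<Sum>j\<in>J. T x j * y j)"
  define L where "L = (\<Sum>i\<in>J. cnj (y i) * T i x)"
  \<comment> \<open>minimizes the form over the value at \<open>x\<close>\<close>
  define y' where "y' = y(x := - R / ?t)"
  have t: "cnj ?t = ?t"
    using psd_on_hermitian[OF _ assms(3), of x x] assms(1) by simp
  have y': "y' x = - R / ?t" "\<And>i. i \<in> J \<Longrightarrow> y' i = y i"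
    using assms(2) by (auto simp: y'_def)
  have e1: "(\<Sum>j\<in>J. cnj (y' x) * T x j * y' j) = cnj (y' x) * R"
    by (simp add: R_def sum_distrib_left mult.assoc y'(2))
  have e2: "(\<Sum>i\<in>J. cnj (y' i) * T i x * y' x) = L * y' x"
    by (simp add: L_def sum_distrib_right y'(2))
  have e3: "(\<Sum>i\<in>J. \<Sum>j\<in>J. cnj (y' i) * T i j * y' j) = (\<Sum>i\<in>J. \<Sum>j\<in>J. cnj (y i) * T i j * y j)"
    by (simp add: y'(2))
  have "0 \<le> (\<Sum>i\<in>insert x J. \<Sum>j\<in>insert x J. cnj (y' i) * T i j * y' j)"
    using assms(3) unfolding psd_on_def by (rule spec)
  also have "\<dots> = (cnj (y' x) * ?t * y' x + cnj (y' x) * R)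
      + (L * y' x + (\<Sum>i\<in>J. \<Sum>j\<in>J. cnj (y i) * T i j * y j))"
    using assms(1,2) by (simp add: sum.distrib e1 e2 e3 add_ac)
  also have "cnj (y' x) * ?t * y' x + cnj (y' x) * R = 0"
    using assms(4) by (simp add: y' t field_simps)
  also have "0 + (L * y' x + (\<Sum>i\<in>J. \<Sum>j\<in>J. cnj (y i) * T i j * y j))
      = (\<Sum>i\<in>J. \<Sum>j\<in>J. cnj (y i) * T i j * y j) - L * R / ?t"
    by (simp add: y')
  also have "L * R / ?t = (\<Sum>i\<in>J. \<Sum>j\<in>J. cnj (y i) * (T i x * T x j / ?t) * y j)"
    unfolding L_def R_def sum_product sum_divide_distrib by (simp add: mult.assoc)
  also have "(\<Sum>i\<in>J. \<Sum>j\<in>J. cnj (y i) * T i j * y j) - \<dots>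
      = (\<Sum>i\<in>J. \<Sum>j\<in>J. cnj (y i) * (T i j - T i x * T x j / ?t) * y j)"
    by (simp add: sum_subtractf right_diff_distrib left_diff_distrib)
  finally show "0 \<le> (\<Sum>i\<in>J. \<Sum>j\<in>J. cnj (y i) * (T i j - T i x * T x j / ?t) * y j)" .
qed

text \<open>
  Gaussian elimination, choosing at each step an index \<open>x\<close> in the lowest remaining block and passing to
  the Schur complement. Since \<open>x\<close> lies in the lowest block, its column reaches at most \<open>N\<close> blocks further,
  and subtracting the corresponding rank one matrix creates no entry outside the band. Indices with zero
  pivot contribute no column, which is why \<open>P\<close> may be smaller than \<open>J\<close>; the remaining columns are in
  echelon form and hence linearly independent.
\<close>

lemma psd_on_Cholesky:
  fixes b :: "'i \<Rightarrow> nat"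
  assumes "finite J" "psd_on J T"
    and "\<And>i j. i \<in> J \<Longrightarrow> j \<in> J \<Longrightarrow> b j + N < b i \<Longrightarrow> T i j = 0"
  obtains P c where "P \<subseteq> J"
    "\<And>i j. i \<in> J \<Longrightarrow> j \<in> J \<Longrightarrow> T i j = (\<Sum>p\<in>P. c p i * cnj (c p j))"
    "\<And>p i. p \<in> P \<Longrightarrow> c p i \<noteq> 0 \<Longrightarrow> i \<in> J \<and> b p \<le> b i \<and> b i \<le> b p + N"
    "\<forall>u. (\<forall>i\<in>J. (\<Sum>p\<in>P. u p * c p i) = 0) \<longrightarrow> (\<forall>p\<in>P. u p = 0)"
proof -
  define Q where "Q J T P c \<longleftrightarrow> P \<subseteq> J \<and> (\<forall>i\<in>J. \<forall>j\<in>J. T i j = (\<Sum>p\<in>P. c p i * cnj (c p j))) \<and>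
      (\<forall>p\<in>P. \<forall>i. c p i \<noteq> 0 \<longrightarrow> i \<in> J \<and> b p \<le> b i \<and> b i \<le> b p + N) \<and>
      (\<forall>u. (\<forall>i\<in>J. (\<Sum>p\<in>P. u p * c p i) = 0) \<longrightarrow> (\<forall>p\<in>P. u p = 0))"
    for J and T :: "'i \<Rightarrow> 'i \<Rightarrow> complex" and P and c :: "'i \<Rightarrow> 'i \<Rightarrow> complex"
  have "\<exists>P c. Q J T P c"
    using assms
  proof (induction J arbitrary: T rule: finite_ranking_induct[where f = "\<lambda>i. - int (b i)", consumes 1, case_names empty insert])
    case empty
    then show ?case unfolding Q_def by auto
  next
    case (insert x S)
    show ?case
    proof (cases "x \<in> S")
      case True
      then show ?thesis using insert by (simp add: insert_absorb)
    next
      case xS: False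
      let ?J = "insert x S"
      have fin: "finite ?J" using insert.hyps(1) by simp
      have bx: "b x \<le> b y" if "y \<in> S" for y using insert.hyps(2)[OF that] by simp
      have herm: "T j i = cnj (T i j)" if "i \<in> ?J" "j \<in> ?J" for i j
        using psd_on_hermitian[OF fin insert.prems(1)] that by blast
      show ?thesis
      proof (cases "T x x = 0")
        case True
        have z: "T x j = 0" "T j x = 0" if "j \<in> ?J" for j
          using psd_on_zero_diag[OF fin insert.prems(1) _ _ True] herm[of x j] that by auto
        have "psd_on S T"
          by (rule psd_on_subset[OF fin insert.prems(1)]) auto
        obtain P c where "Q S T P c"
          using insert.IH[OF \<open>psd_on S T\<close>] insert.prems(2) by auto
        note Pc = this[unfolded Q_def, THEN conjunct1] this[unfolded Q_def, THEN conjunct2, THEN conjunct1]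
          this[unfolded Q_def, THEN conjunct2, THEN conjunct2, THEN conjunct1]
          this[unfolded Q_def, THEN conjunct2, THEN conjunct2, THEN conjunct2]
        have cx: "c p x = 0" if "p \<in> P" for p using Pc(3)[rule_format, of p x] that xS by auto
        have "Q ?J T P c"
          unfolding Q_def
        proof (intro conjI)
          show "P \<subseteq> ?J" using Pc(1) by auto
          show "\<forall>i\<in>?J. \<forall>j\<in>?J. T i j = (\<Sum>p\<in>P. c p i * cnj (c p j))"
            using Pc(2) z cx by simp
          show "\<forall>p\<in>P. \<forall>i. c p i \<noteq> 0 \<longrightarrow> i \<in> ?J \<and> b p \<le> b i \<and> b i \<le> b p + N"
            using Pc(3) by simp
          show "\<forall>u. (\<forall>i\<in>?J. (\<Sum>p\<in>P. u p * c p i) = 0) \<longrightarrow> (\<forall>p\<in>P. u p = 0)"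
          proof (intro allI impI)
            fix u assume "\<forall>i\<in>?J. (\<Sum>p\<in>P. u p * c p i) = 0"
            then show "\<forall>p\<in>P. u p = 0" by (intro Pc(4)[THEN spec, THEN mp]) blast
          qed
        qed
        then show ?thesis by blast
      next
        case tnz: False
        define t where "t = Re (T x x)"
        have t: "T x x = of_real t" "t > 0"
          using psd_on_diag[OF fin insert.prems(1), of x] tnz
          by (auto simp: t_def less_eq_complex_def complex_eq_iff)
        \<comment> \<open>elimination of the nonzero pivot \<open>x\<close>\<close>
        define T' where "T' = (\<lambda>i j. T i j - T i x * T x j / T x x)"
        have T': "psd_on S T'"
          unfolding T'_def using psd_on_Schur_complement[OF insert.hyps(1) xS insert.prems(1) tnz] .
        have band': "T' i j = 0" if "i \<in> S" "j \<in> S" "b j + N < b i" for i j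
        proof -
          have "T i j = 0" "T i x = 0" using insert.prems(2) that bx[of j] by auto
          then show ?thesis by (simp add: T'_def)
        qed
        obtain P c where "Q S T' P c"
          using insert.IH[OF T' band'] by auto
        note Pc = this[unfolded Q_def, THEN conjunct1] this[unfolded Q_def, THEN conjunct2, THEN conjunct1]
          this[unfolded Q_def, THEN conjunct2, THEN conjunct2, THEN conjunct1]
          this[unfolded Q_def, THEN conjunct2, THEN conjunct2, THEN conjunct2]
        have finP: "finite P" and xP: "x \<notin> P" using Pc(1) insert.hyps(1) xS finite_subset by auto
        define d where "d = c(x := \<lambda>i. if i \<in> ?J then T i x / of_real (sqrt t) else 0)"
        have dx: "d x i = T i x / of_real (sqrt t)" if "i \<in> ?J" for i using that by (simp add: d_def)
        have dp: "d p = c p" if "p \<in> P" for p using that xP by (auto simp: d_def)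
        have cx: "c p x = 0" if "p \<in> P" for p using Pc(3)[rule_format, of p x] that xS by auto
        have sum_d: "(\<Sum>p\<in>insert x P. d p i * cnj (d p j))
            = T i x * T x j / T x x + (\<Sum>p\<in>P. c p i * cnj (c p j))" if "i \<in> ?J" "j \<in> ?J" for i j
        proof -
          have "d x i * cnj (d x j) = T i x * T x j / (of_real (sqrt t) * of_real (sqrt t))"
            using herm[of j x] that by (simp add: dx)
          also have "of_real (sqrt t) * of_real (sqrt t) = T x x"
            using t by (simp flip: of_real_mult)
          finally show ?thesis using finP xP by (simp add: dp)
        qed
        have Q1: "T i j = (\<Sum>p\<in>insert x P. d p i * cnj (d p j))" if "i \<in> ?J" "j \<in> ?J" for i j
        proof (cases "i \<in> S \<and> j \<in> S")
          case True
          then show ?thesis unfolding sum_d[OF that] using Pc(2) by (simp add: T'_def algebra_simps)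
        next
          case False
          then have "i = x \<or> j = x" using that by auto
          then show ?thesis unfolding sum_d[OF that] using tnz by (auto simp: cx)
        qed
        have Q2: "\<forall>p\<in>insert x P. \<forall>i. d p i \<noteq> 0 \<longrightarrow> i \<in> ?J \<and> b p \<le> b i \<and> b i \<le> b p + N"
        proof (intro ballI allI impI)
          fix p i assume that: "p \<in> insert x P" "d p i \<noteq> 0"
          show "i \<in> ?J \<and> b p \<le> b i \<and> b i \<le> b p + N"
        proof (cases "p = x")
          case True
          then have i: "i \<in> ?J" "T i x \<noteq> 0" using that by (auto simp: d_def split: if_splits)
          then have "\<not> b x + N < b i" using insert.prems(2)[of i x] by auto
          then show ?thesis using True i bx by auto
        next
          case False
          then show ?thesis using that Pc(3) dp[of p] by simp
        qed
        qed
        have Q3: "\<forall>p\<in>insert x P. u p = 0" if u: "\<forall>i\<in>?J. (\<Sum>p\<in>insert x P. u p * d p i) = 0" for u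
        proof -
          have s: "(\<Sum>p\<in>insert x P. u p * d p i) = u x * d x i + (\<Sum>p\<in>P. u p * c p i)" for i
            using finP xP by (simp add: dp)
          have "u x * d x x = 0" using u s[of x] by (simp add: cx)
          then have ux: "u x = 0" using t by (simp add: dx)
          have "\<forall>i\<in>S. (\<Sum>p\<in>P. u p * c p i) = 0" using u s ux by simp
          then have "\<forall>p\<in>P. u p = 0" by (rule Pc(4)[THEN spec, THEN mp])
          with ux show ?thesis by simp
        qed
        have "Q ?J T (insert x P) d"
          unfolding Q_def
        proof (intro conjI)
          show "insert x P \<subseteq> ?J" using Pc(1) by auto
          show "\<forall>i\<in>?J. \<forall>j\<in>?J. T i j = (\<Sum>p\<in>insert x P. d p i * cnj (d p j))"
            by (intro ballI Q1)
        qed (intro Q2, intro allI impI Q3)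
        then show ?thesis by blast
      qed
    qed
  qed
  then obtain P c where "Q J T P c" by blast
  note Q = this[unfolded Q_def]
  show ?thesis
  proof (rule that[of P c])
    show "\<forall>u. (\<forall>i\<in>J. (\<Sum>p\<in>P. u p * c p i) = 0) \<longrightarrow> (\<forall>p\<in>P. u p = 0)"
      using Q by (elim conjE)
  qed (use Q in blast)+
qed

section \<open>Gram matrices representing a nonnegative trigonometric polynomial\<close>

lemma psd_on_sum_rank_one: "psd_on J (\<lambda>i j. \<Sum>p\<in>P. c p i * cnj (c p j))"
  unfolding psd_on_def
proof
  fix x :: "_ \<Rightarrow> complex"
  have "(\<Sum>i\<in>J. \<Sum>j\<in>J. cnj (x i) * (\<Sum>p\<in>P. c p i * cnj (c p j)) * x j)
      = (\<Sum>i\<in>J. \<Sum>j\<in>J. \<Sum>p\<in>P. cnj (x i) * c p i * cnj (c p j) * x j)"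
    by (simp add: sum_distrib_left sum_distrib_right mult.assoc)
  also have "\<dots> = (\<Sum>i\<in>J. \<Sum>p\<in>P. \<Sum>j\<in>J. cnj (x i) * c p i * cnj (c p j) * x j)"
    by (intro sum.cong[OF refl] sum.swap)
  also have "\<dots> = (\<Sum>p\<in>P. \<Sum>i\<in>J. \<Sum>j\<in>J. cnj (x i) * c p i * cnj (c p j) * x j)"
    by (rule sum.swap)
  also have "\<dots> = (\<Sum>p\<in>P. (\<Sum>i\<in>J. cnj (x i) * c p i) * cnj (\<Sum>j\<in>J. cnj (x j) * c p j))"
    unfolding cnj_sum sum_product by (intro sum.cong refl) (simp add: mult_ac)
  also have "\<dots> = (\<Sum>p\<in>P. of_real ((cmod (\<Sum>i\<in>J. cnj (x i) * c p i))\<^sup>2))"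
    by (simp only: complex_norm_square)
  also have "0 \<le> \<dots>"
    by (simp add: less_eq_complex_def sum_nonneg)
  finally show "0 \<le> (\<Sum>i\<in>J. \<Sum>j\<in>J. cnj (x i) * (\<Sum>p\<in>P. c p i * cnj (c p j)) * x j)" .
qed

lemma psd_on_cong:
  assumes "psd_on J S" "\<And>i j. i \<in> J \<Longrightarrow> j \<in> J \<Longrightarrow> T i j = S i j"
  shows "psd_on J T"
proof -
  have "(\<Sum>i\<in>J. \<Sum>j\<in>J. cnj (x i) * T i j * x j) = (\<Sum>i\<in>J. \<Sum>j\<in>J. cnj (x i) * S i j * x j)" for x
    by (intro sum.cong refl) (simp add: assms(2))
  then show ?thesis using assms(1) unfolding psd_on_def by simp
qed

text \<open>
  The coefficient of \<open>z\<^sup>d\<close> in \<open>\<Sum>\<^sub>s\<^sub>t z\<^sup>s\<^sup>-\<^sup>t G\<^sub>s\<^sub>t\<close>, at matrix position \<open>(i, j)\<close>; the index \<open>(s, i)\<close> of \<open>G\<close>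
  stands for entry \<open>i\<close> of block \<open>s\<close>.
\<close>

definition diag_sum :: "nat \<Rightarrow> (nat \<times> nat \<Rightarrow> nat \<times> nat \<Rightarrow> complex) \<Rightarrow> int \<Rightarrow> nat \<Rightarrow> nat \<Rightarrow> complex" where
  "diag_sum N G d i j = (\<Sum>s\<le>N. \<Sum>t\<le>N. if int s - int t = d then G (s, i) (t, j) else 0)"

abbreviation block_index :: "nat \<Rightarrow> nat \<Rightarrow> (nat \<times> nat) set" where
  "block_index N m \<equiv> {..N} \<times> {..<m}"

text \<open>
  The Gram matrices of all factorizations of the trigonometric polynomial with coefficients \<open>c\<close>. Entries
  outside the index range are pinned to \<open>0\<close> so that this is a compact subset of a function space.
\<close>

definition gram_set :: "nat \<Rightarrow> nat \<Rightarrow> (int \<Rightarrow> nat \<Rightarrow> nat \<Rightarrow> complex) \<Rightarrow> (nat \<times> nat \<Rightarrow> nat \<times> nat \<Rightarrow> complex) set" where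
  "gram_set N m c = {G. (\<forall>p q. p \<notin> block_index N m \<or> q \<notin> block_index N m \<longrightarrow> G p q = 0) \<and>
      psd_on (block_index N m) G \<and> (\<forall>d i j. i < m \<longrightarrow> j < m \<longrightarrow> diag_sum N G d i j = c d i j)}"

lemma has_integral_cis:
  "((\<lambda>t. cis (of_int n * t)) has_integral (if n = 0 then 2 * pi else 0)) {0..2 * pi}"
proof (cases "n = 0")
  case True
  then show ?thesis
    using has_integral_const_real[of "1 :: complex" 0 "2 * pi"] by (simp add: scaleR_conv_of_real)
next
  case False
  have "((\<lambda>t. exp (\<i> * of_int n * of_real t)) has_integral
      exp (\<i> * of_int n * of_real (2 * pi)) / (\<i> * of_int n) - exp (\<i> * of_int n * of_real 0) / (\<i> * of_int n)) {0..2 * pi}"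
    using False
    by (intro fundamental_theorem_of_calculus)
       (auto intro!: derivative_eq_intros has_vector_derivative_real_field)
  moreover have "exp (\<i> * of_int n * of_real (2 * pi)) = 1"
    using cis_multiple_2pi[of "of_int n"] by (simp add: cis_conv_exp mult_ac)
  moreover have "exp (\<i> * of_int n * of_real t) = cis (of_int n * t)" for t
    by (simp add: cis_conv_exp mult_ac)
  ultimately show ?thesis using False by simp
qed

lemma nonneg_integral_complex:
  fixes f :: "real \<Rightarrow> complex"
  assumes cont: "continuous_on {a..b} f" and I: "(f has_integral I) {a..b}"
    and AE: "AE t in lebesgue_on {a..b}. 0 \<le> f t"
  shows "0 \<le> I"
proof -
  have re: "((\<lambda>t. Re (f t)) has_integral Re I) {a..b}" and im: "((\<lambda>t. Im (f t)) has_integral Im I) {a..b}"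
    using I by (auto intro: has_integral_Re has_integral_Im)
  have int: "integrable (lebesgue_on {a..b}) (\<lambda>t. Re (f t))" "integrable (lebesgue_on {a..b}) (\<lambda>t. Im (f t))"
    by (auto intro!: continuous_imp_integrable_real continuous_intros cont)
  have "Re I = integral\<^sup>L (lebesgue_on {a..b}) (\<lambda>t. Re (f t))"
    using lebesgue_integral_eq_integral[OF int(1)] integral_unique[OF re] by simp
  also have "\<dots> \<ge> 0"
    using AE by (intro integral_nonneg_AE) (auto elim!: eventually_mono simp: less_eq_complex_def)
  finally have "0 \<le> Re I" .
  moreover have "Im I = integral\<^sup>L (lebesgue_on {a..b}) (\<lambda>t. Im (f t))"
    using lebesgue_integral_eq_integral[OF int(2)] integral_unique[OF im] by simp
  moreover have "\<dots> = 0"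
    using AE by (intro integral_eq_zero_AE) (auto elim!: eventually_mono simp: less_eq_complex_def)
  ultimately show ?thesis by (simp add: less_eq_complex_def)
qed

text \<open>
  The Toeplitz form at \<open>x\<close> is the mean over the circle of the form of \<open>S(z)\<close> at the vector polynomial
  with coefficients \<open>x\<close>, because integration against \<open>cis\<close> picks out one Fourier coefficient.
\<close>

lemma psd_on_Toeplitz:
  fixes c :: "int \<Rightarrow> nat \<Rightarrow> nat \<Rightarrow> complex"
  assumes AE: "AE t in lebesgue_on {0..2 * pi}. psd_on {..<m} (\<lambda>i j. \<Sum>d\<in>{- int N..int N}. c d i j * cis (of_int d * t))"
    and c0: "\<And>d i j. \<bar>d\<bar> > int N \<Longrightarrow> c d i j = 0"
  shows "psd_on ({..<n} \<times> {..<m}) (\<lambda>p q. c (int (fst p) - int (fst q)) (snd p) (snd q))"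
  unfolding psd_on_def
proof
  fix x :: "nat \<times> nat \<Rightarrow> complex"
  let ?J = "{..<n} \<times> {..<m}"
  define f where "f t = (\<Sum>p\<in>?J. \<Sum>q\<in>?J. \<Sum>d\<in>{- int N..int N}. (cnj (x p) * c d (snd p) (snd q) * x q) *
      cis (of_int (d - (int (fst p) - int (fst q))) * t))" for t
  let ?Q = "\<Sum>p\<in>?J. \<Sum>q\<in>?J. cnj (x p) * c (int (fst p) - int (fst q)) (snd p) (snd q) * x q"
  have "(f has_integral (\<Sum>p\<in>?J. \<Sum>q\<in>?J. \<Sum>d\<in>{- int N..int N}. (cnj (x p) * c d (snd p) (snd q) * x q) *
      of_real (if d - (int (fst p) - int (fst q)) = 0 then 2 * pi else 0))) {0..2 * pi}"
    unfolding f_def by (intro has_integral_sum has_integral_mult_right has_integral_cis) auto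
  moreover have "(\<Sum>d\<in>{- int N..int N}. (cnj (x p) * c d (snd p) (snd q) * x q) *
      of_real (if d - (int (fst p) - int (fst q)) = 0 then 2 * pi else 0))
      = 2 * pi * (cnj (x p) * c (int (fst p) - int (fst q)) (snd p) (snd q) * x q)" for p q
  proof -
    have "(\<Sum>d\<in>{- int N..int N}. (cnj (x p) * c d (snd p) (snd q) * x q) *
        of_real (if d - (int (fst p) - int (fst q)) = 0 then 2 * pi else 0))
      = (\<Sum>d\<in>{- int N..int N}. if d = int (fst p) - int (fst q) then
           2 * pi * (cnj (x p) * c d (snd p) (snd q) * x q) else 0)"
      by (intro sum.cong refl) auto
    also have "\<dots> = 2 * pi * (cnj (x p) * c (int (fst p) - int (fst q)) (snd p) (snd q) * x q)"
      using c0[of "int (fst p) - int (fst q)"] by (auto simp: sum.delta)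
    finally show ?thesis .
  qed
  ultimately have "(f has_integral (2 * pi * ?Q)) {0..2 * pi}"
    by (simp add: sum_distrib_left)
  moreover have "continuous_on {0..2 * pi} f"
    unfolding f_def by (intro continuous_intros)
  moreover have "AE t in lebesgue_on {0..2 * pi}. 0 \<le> f t"
    using AE
  proof eventually_elim
    fix t assume psd: "psd_on {..<m} (\<lambda>i j. \<Sum>d\<in>{- int N..int N}. c d i j * cis (of_int d * t))"
    let ?S = "\<lambda>i j. \<Sum>d\<in>{- int N..int N}. c d i j * cis (of_int d * t)"
    \<comment> \<open>summed over the blocks, \<open>y\<close> is the value at \<open>cis t\<close> of the vector polynomial with coefficients \<open>x\<close>\<close>
    define y where "y p = x p * cis (real (fst p) * t)" for p
    have "f t = (\<Sum>p\<in>?J. \<Sum>q\<in>?J. cnj (y p) * ?S (snd p) (snd q) * y q)"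
      unfolding f_def
    proof (intro sum.cong refl)
      fix p q :: "nat \<times> nat"
      have "cis (of_int (d - (int (fst p) - int (fst q))) * t)
          = cnj (cis (real (fst p) * t)) * cis (of_int d * t) * cis (real (fst q) * t)" for d
        by (simp add: cis_mult cis_cnj algebra_simps)
      then show "(\<Sum>d\<in>{- int N..int N}. (cnj (x p) * c d (snd p) (snd q) * x q) *
            cis (of_int (d - (int (fst p) - int (fst q))) * t)) = cnj (y p) * ?S (snd p) (snd q) * y q"
        by (simp add: y_def sum_distrib_left sum_distrib_right mult_ac)
    qed
    also have "\<dots> = (\<Sum>i<m. \<Sum>a<n. \<Sum>j<m. \<Sum>b<n. cnj (y (a, i)) * ?S i j * y (b, j))"
      by (simp add: sum.cartesian_product' sum.swap[of _ "{..<n}" "{..<m}"])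
    also have "\<dots> = (\<Sum>i<m. \<Sum>j<m. cnj (\<Sum>a<n. y (a, i)) * ?S i j * (\<Sum>b<n. y (b, j)))"
    proof (rule sum.cong[OF refl])
      fix i
      have "(\<Sum>a<n. \<Sum>j<m. \<Sum>b<n. cnj (y (a, i)) * ?S i j * y (b, j))
          = (\<Sum>j<m. \<Sum>a<n. \<Sum>b<n. cnj (y (a, i)) * ?S i j * y (b, j))"
        by (rule sum.swap)
      also have "\<dots> = (\<Sum>j<m. cnj (\<Sum>a<n. y (a, i)) * ?S i j * (\<Sum>b<n. y (b, j)))"
      proof (rule sum.cong[OF refl])
        fix j
        show "(\<Sum>a<n. \<Sum>b<n. cnj (y (a, i)) * ?S i j * y (b, j))
            = cnj (\<Sum>a<n. y (a, i)) * ?S i j * (\<Sum>b<n. y (b, j))"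
          unfolding cnj_sum by (subst sum_distrib_right) (rule sum_product[symmetric])
      qed
      finally show "(\<Sum>a<n. \<Sum>j<m. \<Sum>b<n. cnj (y (a, i)) * ?S i j * y (b, j))
          = (\<Sum>j<m. cnj (\<Sum>a<n. y (a, i)) * ?S i j * (\<Sum>b<n. y (b, j)))" .
    qed
    also have "0 \<le> \<dots>"
      using psd unfolding psd_on_def by (rule spec)
    finally show "0 \<le> f t" .
  qed
  ultimately have "0 \<le> 2 * pi * ?Q"
    by (intro nonneg_integral_complex)
  moreover have "0 \<le> 2 * pi * S \<Longrightarrow> 0 \<le> S" for S :: complex
    using pi_gt_zero by (simp add: less_eq_complex_def zero_le_mult_iff)
  ultimately show "0 \<le> ?Q" by blast
qed

lemma sum_shift_window:
  fixes h :: "nat \<Rightarrow> 'a :: comm_monoid_add"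
  assumes "\<And>a. h a \<noteq> 0 \<Longrightarrow> f \<le> a \<and> a \<le> f + N \<and> a < n"
  shows "(\<Sum>s\<le>N. h (f + s)) = (\<Sum>a<n. h a)"
proof -
  have "(\<Sum>s\<le>N. h (f + s)) = (\<Sum>a\<in>{f..f + N}. h a)"
    by (rule sum.reindex_bij_witness[of _ "\<lambda>a. a - f" "\<lambda>s. f + s"]) auto
  also have "\<dots> = (\<Sum>a\<in>{f..f + N} \<inter> {..<n}. h a)"
    using assms by (intro sum.mono_neutral_right) auto
  also have "\<dots> = (\<Sum>a<n. h a)"
    using assms by (intro sum.mono_neutral_left) auto
  finally show ?thesis .
qed

lemma diag_sum_sum: "diag_sum N (\<lambda>p q. \<Sum>r\<in>P. f r p q) d i j = (\<Sum>r\<in>P. diag_sum N (f r) d i j)"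
proof -
  have "diag_sum N (\<lambda>p q. \<Sum>r\<in>P. f r p q) d i j
      = (\<Sum>s\<le>N. \<Sum>t\<le>N. \<Sum>r\<in>P. if int s - int t = d then f r (s, i) (t, j) else 0)"
    unfolding diag_sum_def by (intro sum.cong refl) auto
  also have "\<dots> = (\<Sum>s\<le>N. \<Sum>r\<in>P. \<Sum>t\<le>N. if int s - int t = d then f r (s, i) (t, j) else 0)"
    by (intro sum.cong[OF refl] sum.swap)
  also have "\<dots> = (\<Sum>r\<in>P. diag_sum N (f r) d i j)"
    unfolding diag_sum_def by (rule sum.swap)
  finally show ?thesis .
qed

lemma diag_sum_cong:
  assumes "\<And>s t. s \<le> N \<Longrightarrow> t \<le> N \<Longrightarrow> int s - int t = d \<Longrightarrow> G (s, i) (t, j) = H (s, i) (t, j)"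
  shows "diag_sum N G d i j = diag_sum N H d i j"
  unfolding diag_sum_def by (intro sum.cong refl) (auto intro: assms)

lemma diag_sum_add: "diag_sum N (\<lambda>p q. f p q + g p q) d i j = diag_sum N f d i j + diag_sum N g d i j"
  unfolding diag_sum_def sum.distrib[symmetric] by (intro sum.cong refl) simp

lemma diag_sum_diff: "diag_sum N (\<lambda>p q. f p q - g p q) d i j = diag_sum N f d i j - diag_sum N g d i j"
  unfolding diag_sum_def sum_subtractf[symmetric] by (intro sum.cong refl) simp

lemma diag_sum_mult: "diag_sum N (\<lambda>p q. a * f p q) d i j = a * diag_sum N f d i j"
  unfolding diag_sum_def sum_distrib_left by (intro sum.cong refl) simp

lemma count_diagonal:
  assumes "\<bar>d\<bar> \<le> int n"
  shows "(\<Sum>a<n. \<Sum>b<n. if int a - int b = d then 1 else 0 :: complex) = of_int (int n - \<bar>d\<bar>)"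
proof -
  have count: "(\<Sum>b<n. if b + e < n then 1 else 0 :: complex) = of_nat (n - e)" for e
  proof -
    have "(\<Sum>b<n. if b + e < n then 1 else 0 :: complex) = (\<Sum>b<n - e. 1)"
      by (rule sum.mono_neutral_cong_right) auto
    then show ?thesis by simp
  qed
  define e where "e = nat \<bar>d\<bar>"
  have le: "e \<le> n" using assms by (simp add: e_def)
  have ne: "of_int (int n - \<bar>d\<bar>) = (of_nat (n - e) :: complex)"
    using le by (simp add: e_def of_nat_diff)
  have delta: "(\<Sum>a<n. if a = b + e then 1 else 0 :: complex) = (if b + e < n then 1 else 0)" for b
    by (simp add: sum.delta)
  show ?thesis
  proof (cases "d \<ge> 0")
    case True
    have "(\<Sum>a<n. \<Sum>b<n. if int a - int b = d then 1 else 0 :: complex)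
        = (\<Sum>b<n. \<Sum>a<n. if int a - int b = d then 1 else 0)" by (rule sum.swap)
    also have "\<dots> = (\<Sum>b<n. \<Sum>a<n. if a = b + e then 1 else 0)"
      using True by (intro sum.cong refl if_cong) (auto simp: e_def)
    finally show ?thesis unfolding delta count ne .
  next
    case False
    have "(\<Sum>a<n. \<Sum>b<n. if int a - int b = d then 1 else 0 :: complex)
        = (\<Sum>b<n. \<Sum>a<n. if a = b + e then 1 else 0)"
      using False by (intro sum.cong refl if_cong) (auto simp: e_def)
    then show ?thesis unfolding delta count ne .
  qed
qed

text \<open>
  Column \<open>r\<close> of the Cholesky factor of the Toeplitz matrix lives in the blocks \<open>fst r, ..., fst r + N\<close>.
  Moving it down by \<open>fst r\<close> blocks keeps the differences of block numbers, hence the total contribution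
  of all columns to the \<open>d\<close>-th diagonal is unchanged. In the Toeplitz matrix this diagonal consists
  of \<open>n - |d|\<close> copies of the coefficient \<open>c d\<close>.
\<close>

lemma ex_averaged_gram:
  fixes c :: "int \<Rightarrow> nat \<Rightarrow> nat \<Rightarrow> complex"
  assumes c0: "\<And>d i j. \<bar>d\<bar> > int N \<Longrightarrow> c d i j = 0" and n: "n \<ge> N" "n > 0"
    and psd: "psd_on ({..<n} \<times> {..<m}) (\<lambda>p q. c (int (fst p) - int (fst q)) (snd p) (snd q))"
  shows "\<exists>G. G \<in> gram_set N m (\<lambda>d i j. (1 - of_int \<bar>d\<bar> / of_nat n) * c d i j)"
proof -
  let ?J = "{..<n} \<times> {..<m}" and ?T = "\<lambda>p q. c (int (fst p) - int (fst q)) (snd p) (snd q)"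
  have fin: "finite ?J" by simp
  have band: "?T p q = 0" if "p \<in> ?J" "q \<in> ?J" "fst q + N < fst p" for p q
    by (rule c0) (use that in auto)
  obtain P f where P: "P \<subseteq> ?J"
    and T: "\<And>p q. p \<in> ?J \<Longrightarrow> q \<in> ?J \<Longrightarrow> ?T p q = (\<Sum>r\<in>P. f r p * cnj (f r q))"
    and supp: "\<And>r p. r \<in> P \<Longrightarrow> f r p \<noteq> 0 \<Longrightarrow> p \<in> ?J \<and> fst r \<le> fst p \<and> fst p \<le> fst r + N"
    by (rule psd_on_Cholesky[of ?J ?T fst N, OF fin psd]) (erule (2) band, rule that)
  define g where "g r p = f r (fst r + fst p, snd p)" for r p
  define G where "G p q = (if p \<in> block_index N m \<and> q \<in> block_index N m
      then (\<Sum>r\<in>P. (1 / of_real (sqrt n) * g r p) * cnj (1 / of_real (sqrt n) * g r q)) else 0)" for p q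
  have nn: "complex_of_real (sqrt n) * complex_of_real (sqrt n) = of_nat n"
    by (simp flip: of_real_mult)
  have "diag_sum N G d i j = (1 - of_int \<bar>d\<bar> / of_nat n) * c d i j" if ij: "i < m" "j < m" for d i j
  proof -
    have "diag_sum N G d i j = diag_sum N (\<lambda>p q. \<Sum>r\<in>P. (1 / of_nat n) * (g r p * cnj (g r q))) d i j"
      by (rule diag_sum_cong) (use ij in \<open>auto simp: G_def nn intro!: sum.cong\<close>)
    also have "\<dots> = (\<Sum>r\<in>P. (1 / of_nat n) * diag_sum N (\<lambda>p q. g r p * cnj (g r q)) d i j)"
      unfolding diag_sum_sum diag_sum_mult ..
    also have "\<dots> = (1 / of_nat n) * (\<Sum>r\<in>P. \<Sum>a<n. \<Sum>b<n.
        if int a - int b = d then f r (a, i) * cnj (f r (b, j)) else 0)"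
      unfolding sum_distrib_left[symmetric]
    proof (intro arg_cong2[where f = "(*)"] refl sum.cong)
      fix r assume r: "r \<in> P"
      let ?h = "\<lambda>a b. if int a - int b = d then f r (a, i) * cnj (f r (b, j)) else 0"
      have "diag_sum N (\<lambda>p q. g r p * cnj (g r q)) d i j = (\<Sum>s\<le>N. \<Sum>t\<le>N. ?h (fst r + s) (fst r + t))"
        unfolding diag_sum_def g_def by (intro sum.cong refl if_cong) auto
      also have "\<dots> = (\<Sum>s\<le>N. \<Sum>b<n. ?h (fst r + s) b)"
        using supp[OF r] by (intro sum.cong refl sum_shift_window) (force split: if_splits)
      also have "\<dots> = (\<Sum>b<n. \<Sum>s\<le>N. ?h (fst r + s) b)"
        by (rule sum.swap)
      also have "\<dots> = (\<Sum>b<n. \<Sum>a<n. ?h a b)"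
        using supp[OF r] by (intro sum.cong refl sum_shift_window[where h = "\<lambda>a. ?h a _"]) (force split: if_splits)
      also have "\<dots> = (\<Sum>a<n. \<Sum>b<n. ?h a b)"
        by (rule sum.swap)
      finally show "diag_sum N (\<lambda>p q. g r p * cnj (g r q)) d i j = (\<Sum>a<n. \<Sum>b<n. ?h a b)" .
    qed
    also have "(\<Sum>r\<in>P. \<Sum>a<n. \<Sum>b<n. if int a - int b = d then f r (a, i) * cnj (f r (b, j)) else 0)
        = (\<Sum>a<n. \<Sum>r\<in>P. \<Sum>b<n. if int a - int b = d then f r (a, i) * cnj (f r (b, j)) else 0)"
      by (rule sum.swap)
    also have "\<dots> = (\<Sum>a<n. \<Sum>b<n. \<Sum>r\<in>P. if int a - int b = d then f r (a, i) * cnj (f r (b, j)) else 0)"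
      by (intro sum.cong[OF refl] sum.swap)
    also have "\<dots> = (\<Sum>a<n. \<Sum>b<n. c d i j * (if int a - int b = d then 1 else 0))"
    proof (intro sum.cong refl)
      fix a b assume ab: "a \<in> {..<n}" "b \<in> {..<n}"
      show "(\<Sum>r\<in>P. if int a - int b = d then f r (a, i) * cnj (f r (b, j)) else 0)
          = c d i j * (if int a - int b = d then 1 else 0)"
        using T[of "(a, i)" "(b, j)"] ab ij by auto
    qed
    also have "\<dots> = c d i j * (\<Sum>a<n. \<Sum>b<n. if int a - int b = d then 1 else 0)"
      by (simp only: sum_distrib_left)
    also have "(1 / of_nat n) * \<dots> = (1 - of_int \<bar>d\<bar> / of_nat n) * c d i j"
    proof (cases "\<bar>d\<bar> \<le> int n")
      case True
      then show ?thesis unfolding count_diagonal[OF True] using n(2) by (simp add: field_simps)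
    next
      case False
      then show ?thesis using n c0[of d i j] by simp
    qed
    finally show ?thesis .
  qed
  moreover have "psd_on (block_index N m) G"
    by (rule psd_on_cong[OF psd_on_sum_rank_one[of _ "\<lambda>r p. 1 / of_real (sqrt n) * g r p" P]])
       (simp only: G_def if_True simp_thms)
  ultimately have "G \<in> gram_set N m (\<lambda>d i j. (1 - of_int \<bar>d\<bar> / of_nat n) * c d i j)"
    unfolding gram_set_def by (auto simp: G_def)
  then show ?thesis by blast
qed


text \<open>
  Tychonoff's theorem, for the topology of pointwise convergence on functions.
\<close>

lemma compact_all_coordinates:
  fixes S :: "'i \<Rightarrow> 'a :: topological_space set"
  assumes "\<And>i. compact (S i)"
  shows "compact {f. \<forall>i. f i \<in> S i}"
proof -
  have "compactin (product_topology (\<lambda>_. euclidean) UNIV) (Pi\<^sub>E UNIV S)"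
    unfolding compactin_PiE using assms by simp
  moreover have "Pi\<^sub>E UNIV S = {f. \<forall>i. f i \<in> S i}"
    by (auto simp: PiE_def extensional_def)
  ultimately show ?thesis by (simp add: euclidean_product_topology)
qed

lemma continuous_on_entry: "continuous_on A (\<lambda>G :: 'i \<Rightarrow> 'j \<Rightarrow> 'a :: topological_space. G i j)"
proof -
  have "continuous_on A (\<lambda>G :: 'i \<Rightarrow> 'j \<Rightarrow> 'a. G i)"
    by (rule continuous_on_product_then_coordinatewise[OF continuous_on_id])
  then show ?thesis by (rule continuous_on_product_then_coordinatewise)
qed

lemma continuous_on_diag_sum: "continuous_on A (\<lambda>G. diag_sum N G d i j)"
proof -
  have "continuous_on A (\<lambda>G. if P then G p q else (0 :: complex))" for P and p q :: "nat \<times> nat"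
    by (cases P) (simp_all add: continuous_on_entry)
  then show ?thesis
    unfolding diag_sum_def by (intro continuous_on_sum)
qed

text \<open>
  Diagonal entries are nonnegative and their sums along the blocks are prescribed; they dominate all
  other entries of a positive semidefinite matrix.
\<close>

lemma gram_set_bound:
  assumes G: "G \<in> gram_set N m c"
  shows "cmod (G p q) \<le> (\<Sum>i<m. cmod (c 0 i i))"
proof (cases "p \<in> block_index N m \<and> q \<in> block_index N m")
  case True
  let ?J = "block_index N m"
  have psd: "psd_on ?J G" and fin: "finite ?J" using G by (auto simp: gram_set_def)
  have diag: "0 \<le> Re (G r r)" if "r \<in> ?J" for r
    using psd_on_diag[OF fin psd that] by (simp add: less_eq_complex_def)
  have "Re (G r r) \<le> (\<Sum>i<m. cmod (c 0 i i))" if r: "r \<in> ?J" for r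
  proof -
    obtain s i where si: "r = (s, i)" "s \<le> N" "i < m" using r by auto
    have "Re (G r r) \<le> (\<Sum>s\<le>N. Re (G (s, i) (s, i)))"
      unfolding si(1) using si(2,3) by (intro member_le_sum diag) auto
    also have "\<dots> = Re (diag_sum N G 0 i i)"
      by (simp add: diag_sum_def)
    also have "\<dots> = Re (c 0 i i)" using G si(3) by (simp add: gram_set_def)
    also have "\<dots> \<le> cmod (c 0 i i)" by (rule complex_Re_le_cmod)
    also have "\<dots> \<le> (\<Sum>i<m. cmod (c 0 i i))"
      using si(3) by (intro member_le_sum) auto
    finally show ?thesis .
  qed
  from this[of p] this[of q] psd_on_bound[OF fin psd, of p q] True show ?thesis by linarith
next
  case False
  then have "G p q = 0" using G unfolding gram_set_def by blast
  then show ?thesis by (simp add: sum_nonneg)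
qed

lemma closed_psd_on: "closed {G. psd_on J G}"
  unfolding psd_on_def less_eq_complex_def
  by (intro closed_Collect_all closed_Collect_conj closed_Collect_le closed_Collect_eq continuous_intros
      continuous_on_entry)

lemma closed_gram_set: "closed (gram_set N m c)"
proof -
  have 1: "closed {G :: nat \<times> nat \<Rightarrow> nat \<times> nat \<Rightarrow> complex.
      P \<longrightarrow> G p q = 0}" for P p q
    by (intro closed_Collect_imp open_Collect_const closed_Collect_eq continuous_on_entry continuous_on_const)
  have 2: "closed {G. i < m \<longrightarrow> j < m \<longrightarrow> diag_sum N G d i j = c d i j}" for d i j
    by (intro closed_Collect_imp open_Collect_const closed_Collect_eq continuous_on_diag_sum continuous_on_const)
  show ?thesis
    unfolding gram_set_def by (intro closed_Collect_conj closed_Collect_all closed_psd_on 1 2)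
qed

lemma compact_bounded_entries: "compact {G :: 'i \<Rightarrow> 'j \<Rightarrow> complex. \<forall>p q. cmod (G p q) \<le> R}"
proof -
  have "compact {G :: 'i \<Rightarrow> 'j \<Rightarrow> complex. \<forall>p. G p \<in> {h. \<forall>q. h q \<in> cball 0 R}}"
    by (intro compact_all_coordinates compact_cball)
  then show ?thesis by simp
qed

lemma compact_gram_set: "compact (gram_set N m c)"
proof -
  let ?K = "{G :: nat \<times> nat \<Rightarrow> nat \<times> nat \<Rightarrow> complex. \<forall>p q. cmod (G p q) \<le> (\<Sum>i<m. cmod (c 0 i i))}"
  have "compact (?K \<inter> gram_set N m c)"
    by (intro compact_Int_closed compact_bounded_entries closed_gram_set)
  moreover have "?K \<inter> gram_set N m c = gram_set N m c"
    using gram_set_bound[of _ N m c] by blast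
  ultimately show ?thesis by simp
qed

lemma gram_set_nonempty:
  fixes c :: "int \<Rightarrow> nat \<Rightarrow> nat \<Rightarrow> complex"
  assumes c0: "\<And>d i j. \<bar>d\<bar> > int N \<Longrightarrow> c d i j = 0"
    and psd: "\<And>n. psd_on ({..<n} \<times> {..<m}) (\<lambda>p q. c (int (fst p) - int (fst q)) (snd p) (snd q))"
  shows "gram_set N m c \<noteq> {}"
proof -
  define K where "K = {G :: nat \<times> nat \<Rightarrow> nat \<times> nat \<Rightarrow> complex. \<forall>p q. cmod (G p q) \<le> (\<Sum>i<m. cmod (c 0 i i))}"
  have "compact K" unfolding K_def by (rule compact_bounded_entries)
  then have "seq_compact K" by (rule compact_imp_seq_compact)
  \<comment> \<open>the index is moved by \<open>N\<close> so that the averaging lemma applies to every \<open>n\<close>\<close>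
  define c' where "c' n d i j = (1 - of_int \<bar>d\<bar> / of_nat (Suc (n + N))) * c d i j" for n d i j
  have "\<exists>G. G \<in> gram_set N m (c' n)" for n
    using ex_averaged_gram[OF c0 _ _ psd, of N "Suc (n + N)"] unfolding c'_def by simp
  then obtain H where H: "\<And>n. H n \<in> gram_set N m (c' n)" by metis
  have "H n \<in> K" for n
    using gram_set_bound[OF H[of n]] unfolding K_def by (simp add: c'_def)
  then obtain G r where G: "G \<in> K" "strict_mono r" "(H \<circ> r) \<longlonglongrightarrow> G"
    using \<open>seq_compact K\<close> unfolding seq_compact_def by metis
  have lim: "(\<lambda>n. f (H (r n))) \<longlonglongrightarrow> f G" if "continuous_on UNIV f" for f :: "_ \<Rightarrow> complex"
  proof -
    show ?thesis using continuous_on_tendsto_compose[OF that G(3)] by (simp add: o_def)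
  qed
  have "G p q = 0" if "p \<notin> block_index N m \<or> q \<notin> block_index N m" for p q
  proof -
    have "H n p q = 0" for n using H[of n] that unfolding gram_set_def by blast
    then have "(\<lambda>n. 0) \<longlonglongrightarrow> G p q" using lim[OF continuous_on_entry, of p q] by simp
    then show ?thesis by (simp add: LIMSEQ_const_iff)
  qed
  moreover have "psd_on (block_index N m) G"
  proof -
    have "G \<in> {G. psd_on (block_index N m) G}"
      by (rule closed_sequentially[OF closed_psd_on _ G(3)]) (use H in \<open>auto simp: gram_set_def\<close>)
    then show ?thesis by simp
  qed
  moreover have "diag_sum N G d i j = c d i j" if ij: "i < m" "j < m" for d i j
  proof (rule LIMSEQ_unique[OF lim[OF continuous_on_diag_sum]])
    have "(\<lambda>n. (1 - of_int \<bar>d\<bar> / of_nat (Suc (n + N))) * c d i j) \<longlonglongrightarrow> (1 - 0) * c d i j"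
      by (intro tendsto_intros tendsto_divide_0[OF tendsto_const] filterlim_compose[OF tendsto_of_nat] filterlim_subseq)
         (auto simp: strict_mono_def)
    then have "(\<lambda>n. c' n d i j) \<longlonglongrightarrow> c d i j" by (simp add: c'_def)
    then have "(\<lambda>n. c' (r n) d i j) \<longlonglongrightarrow> c d i j"
      using LIMSEQ_subseq_LIMSEQ[OF _ G(2)] by (fastforce simp: o_def)
    moreover have "diag_sum N (H (r n)) d i j = c' (r n) d i j" for n
      using H[of "r n"] ij by (auto simp: gram_set_def)
    ultimately show "(\<lambda>n. diag_sum N (H (r n)) d i j) \<longlonglongrightarrow> c d i j" by simp
  qed
  ultimately have "G \<in> gram_set N m c" unfolding gram_set_def by blast
  then show ?thesis by blast
qed

lemma ex_extremal_gram:
  assumes "gram_set N m c \<noteq> {}"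
  obtains G where "G \<in> gram_set N m c"
    "\<And>H. H \<in> gram_set N m c \<Longrightarrow> (\<Sum>i<m. Re (H (0, i) (0, i))) \<le> (\<Sum>i<m. Re (G (0, i) (0, i)))"
proof -
  have "continuous_on (gram_set N m c) (\<lambda>G. \<Sum>i<m. Re (G (0, i) (0, i)))"
    by (intro continuous_intros continuous_on_entry)
  from continuous_attains_sup[OF compact_gram_set assms this] that show ?thesis by blast
qed


section \<open>A Gram matrix of maximal leading block\<close>

text \<open>
  Multiplication of the vector polynomial with coefficients \<open>x\<close> by \<open>z\<close>.
\<close>

definition shift_rows :: "(nat \<times> nat \<Rightarrow> complex) \<Rightarrow> nat \<times> nat \<Rightarrow> complex" where
  "shift_rows x p = (if fst p = 0 then 0 else x (fst p - 1, snd p))"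

text \<open>
  Multiplication by \<open>z\<close> does not change \<open>x x\<^sup>*\<close> on the circle.
\<close>

lemma diag_sum_shift_rows:
  assumes "\<And>i. x (N, i) = 0"
  shows "diag_sum N (\<lambda>p q. shift_rows x p * cnj (shift_rows x q)) d i j = diag_sum N (\<lambda>p q. x p * cnj (x q)) d i j"
proof (cases N)
  case 0
  then show ?thesis using assms by (simp add: diag_sum_def shift_rows_def)
next
  case (Suc M)
  let ?f = "\<lambda>s t. if int s - int t = d then x (s, i) * cnj (x (t, j)) else 0"
  have "diag_sum N (\<lambda>p q. shift_rows x p * cnj (shift_rows x q)) d i j = (\<Sum>s\<le>M. \<Sum>t\<le>M. ?f s t)"
    unfolding diag_sum_def Suc sum.atMost_Suc_shift by (simp add: shift_rows_def cong: if_cong)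
  also have "\<dots> = diag_sum N (\<lambda>p q. x p * cnj (x q)) d i j"
    unfolding diag_sum_def Suc sum.atMost_Suc using assms by (simp add: Suc cong: if_cong)
  finally show ?thesis .
qed

text \<open>
  Let \<open>h = F u\<close> for a unit vector \<open>u\<close>. Replacing \<open>F\<close> by \<open>F + (e - h) u\<^sup>*\<close> exchanges the component \<open>h\<close> in the
  direction \<open>u\<close> for \<open>e\<close> and changes the Gram matrix by \<open>e e\<^sup>* - h h\<^sup>*\<close>, so the new Gram matrix is admissible
  if \<open>e\<close> and \<open>h\<close> have the same autocorrelation. Maximality bounds the leading coefficient of \<open>e\<close>.
\<close>

lemma extremal_replacement:
  assumes G: "G \<in> gram_set N m c"
    and max: "\<And>H. H \<in> gram_set N m c \<Longrightarrow> (\<Sum>i<m. Re (H (0, i) (0, i))) \<le> (\<Sum>i<m. Re (G (0, i) (0, i)))"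
    and F: "\<And>p q. p \<in> block_index N m \<Longrightarrow> q \<in> block_index N m \<Longrightarrow> G p q = (\<Sum>r\<in>P. F r p * cnj (F r q))"
    and u: "(\<Sum>r\<in>P. u r * cnj (u r)) = 1"
    and h: "\<And>p. h p = (\<Sum>r\<in>P. u r * F r p)"
    and eh: "\<And>d i j. i < m \<Longrightarrow> j < m \<Longrightarrow> diag_sum N (\<lambda>p q. e p * cnj (e q)) d i j = diag_sum N (\<lambda>p q. h p * cnj (h q)) d i j"
  shows "(\<Sum>i<m. (cmod (e (0, i)))\<^sup>2) \<le> (\<Sum>i<m. (cmod (h (0, i)))\<^sup>2)"
proof -
  let ?J = "block_index N m"
  define H where "H p q = (if p \<in> ?J \<and> q \<in> ?J then G p q + (e p * cnj (e q) - h p * cnj (h q)) else 0)" for p q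
  have gram: "H p q = (\<Sum>r\<in>P. (F r p + (e p - h p) * cnj (u r)) * cnj (F r q + (e q - h q) * cnj (u r)))"
    if pq: "p \<in> ?J" "q \<in> ?J" for p q
  proof -
    have "(\<Sum>r\<in>P. (F r p + (e p - h p) * cnj (u r)) * cnj (F r q + (e q - h q) * cnj (u r)))
        = (\<Sum>r\<in>P. F r p * cnj (F r q) + cnj (e q - h q) * (u r * F r p)
            + (e p - h p) * cnj (u r * F r q) + (e p - h p) * cnj (e q - h q) * (u r * cnj (u r)))"
      by (intro sum.cong refl) (simp add: algebra_simps)
    also have "\<dots> = G p q + cnj (e q - h q) * h p + (e p - h p) * cnj (h q) + (e p - h p) * cnj (e q - h q) * 1"
      unfolding F[OF pq] h cnj_sum u[symmetric] by (simp only: sum.distrib sum_distrib_left)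
    also have "\<dots> = H p q"
      using pq by (simp add: H_def algebra_simps)
    finally show ?thesis by simp
  qed
  have "psd_on ?J H"
    by (rule psd_on_cong[OF psd_on_sum_rank_one gram])
  moreover have "diag_sum N H d i j = c d i j" if ij: "i < m" "j < m" for d i j
  proof -
    have "diag_sum N H d i j = diag_sum N (\<lambda>p q. G p q + (e p * cnj (e q) - h p * cnj (h q))) d i j"
      by (rule diag_sum_cong) (use ij in \<open>simp add: H_def\<close>)
    also have "\<dots> = diag_sum N G d i j"
      unfolding diag_sum_add diag_sum_diff eh[OF ij] by simp
    finally show ?thesis using G ij by (simp add: gram_set_def)
  qed
  ultimately have "H \<in> gram_set N m c"
    unfolding gram_set_def by (auto simp: H_def)
  from max[OF this] have "(\<Sum>i<m. Re (H (0, i) (0, i))) \<le> (\<Sum>i<m. Re (G (0, i) (0, i)))" .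
  moreover have "(\<Sum>i<m. Re (H (0, i) (0, i)))
      = (\<Sum>i<m. Re (G (0, i) (0, i)) + ((cmod (e (0, i)))\<^sup>2 - (cmod (h (0, i)))\<^sup>2))"
    by (intro sum.cong refl) (simp add: H_def cmod_power2 flip: power2_eq_square)
  ultimately show ?thesis by (simp add: sum.distrib sum_subtractf)
qed

text \<open>
  If \<open>h(z) = (z - a) q(z)\<close>, then \<open>e(z) = (1 - cnj a z) q(z)\<close> satisfies \<open>e e\<^sup>* = h h\<^sup>*\<close> on the circle, that is, it
  has the same autocorrelation, but \<open>e(0) = q(0)\<close> while \<open>h(0) = - a q(0)\<close>. By maximality \<open>q(0) = 0\<close>, so \<open>h(0) = 0\<close>.
  Then \<open>h(z) / z\<close> is again a competitor for \<open>h\<close>, its value at \<open>0\<close> must vanish as well, and inductively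
  all coefficients of \<open>h\<close> are zero.
\<close>

lemma extremal_gram_no_zero:
  assumes G: "G \<in> gram_set N m c"
    and max: "\<And>H. H \<in> gram_set N m c \<Longrightarrow> (\<Sum>i<m. Re (H (0, i) (0, i))) \<le> (\<Sum>i<m. Re (G (0, i) (0, i)))"
    and F: "\<And>p q. p \<in> block_index N m \<Longrightarrow> q \<in> block_index N m \<Longrightarrow> G p q = (\<Sum>r\<in>P. F r p * cnj (F r q))"
    and u: "(\<Sum>r\<in>P. u r * cnj (u r)) = 1"
    and a: "cmod a < 1" and root: "\<And>i. i < m \<Longrightarrow> (\<Sum>s\<le>N. (\<Sum>r\<in>P. u r * F r (s, i)) * a ^ s) = 0"
    and s: "s \<le> N" "i < m"
  shows "(\<Sum>r\<in>P. u r * F r (s, i)) = 0"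
proof -
  define h where "h p = (\<Sum>r\<in>P. u r * F r p)" for p
  have replace: "(\<Sum>i<m. (cmod (e (0, i)))\<^sup>2) \<le> (\<Sum>i<m. (cmod (h (0, i)))\<^sup>2)"
    if "\<And>d i j. i < m \<Longrightarrow> j < m \<Longrightarrow> diag_sum N (\<lambda>p q. e p * cnj (e q)) d i j = diag_sum N (\<lambda>p q. h p * cnj (h q)) d i j" for e
    using G max F u h_def that by (rule extremal_replacement)
  have vanish: "\<forall>i<m. e (0, i) = 0" if "(\<Sum>i<m. (cmod (e (0, i)))\<^sup>2) \<le> 0" for e :: "nat \<times> nat \<Rightarrow> complex"
  proof -
    have "(\<Sum>i<m. (cmod (e (0, i)))\<^sup>2) = 0" using that by (intro antisym sum_nonneg) auto
    then show ?thesis by (subst (asm) sum_nonneg_eq_0_iff) auto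
  qed
  have "\<exists>q. (\<Sum>s\<le>N. monom (h (s, i)) s) = [:-a, 1:] * q \<and> coeff q N = 0" if i: "i < m" for i
  proof -
    let ?p = "\<Sum>s\<le>N. monom (h (s, i)) s"
    have "poly ?p a = 0" using root[OF i] by (simp add: poly_sum poly_monom h_def)
    then obtain q where q: "?p = [:-a, 1:] * q" by (auto simp: poly_eq_0_iff_dvd elim: dvdE)
    have "degree ?p \<le> N" by (intro degree_sum_le) (auto intro: degree_monom_le le_trans)
    have "coeff q N = 0"
    proof (rule ccontr)
      assume nz: "coeff q N \<noteq> 0"
      then have "N \<le> degree q" "q \<noteq> 0" by (auto intro: le_degree)
      then have "degree ?p = Suc (degree q)" unfolding q by (subst degree_mult_eq) auto
      with \<open>degree ?p \<le> N\<close> \<open>N \<le> degree q\<close> show False by simp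
    qed
    with q show ?thesis by blast
  qed
  then obtain q where q: "\<And>i. i < m \<Longrightarrow> (\<Sum>s\<le>N. monom (h (s, i)) s) = [:-a, 1:] * q i"
    "\<And>i. i < m \<Longrightarrow> coeff (q i) N = 0" by metis
  \<comment> \<open>the coefficients of \<open>q\<close>, in the index convention of Gram matrices\<close>
  define x where "x p = (if snd p < m then coeff (q (snd p)) (fst p) else 0)" for p
  have hx: "h (s, i) = shift_rows x (s, i) - a * x (s, i)" if "i < m" "s \<le> N" for s i
  proof -
    have "h (s, i) = coeff (\<Sum>s\<le>N. monom (h (s, i)) s) s"
      using that(2) by (simp add: coeff_sum coeff_monom sum.delta)
    also have "\<dots> = shift_rows x (s, i) - a * x (s, i)"
      unfolding q(1)[OF that(1)] using that(1)
      by (cases s) (auto simp: shift_rows_def x_def coeff_pCons)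
    finally show ?thesis .
  qed
  define e where "e p = x p - cnj a * shift_rows x p" for p
  have "diag_sum N (\<lambda>p q. e p * cnj (e q)) d i j = diag_sum N (\<lambda>p q. h p * cnj (h q)) d i j"
    if ij: "i < m" "j < m" for d i j
  proof -
    let ?y = "shift_rows x"
    have "diag_sum N (\<lambda>p q. e p * cnj (e q)) d i j
        = diag_sum N (\<lambda>p q. h p * cnj (h q) + (1 - a * cnj a) * (x p * cnj (x q) - ?y p * cnj (?y q))) d i j"
      by (rule diag_sum_cong) (simp add: hx ij e_def algebra_simps)
    also have "\<dots> = diag_sum N (\<lambda>p q. h p * cnj (h q)) d i j"
      unfolding diag_sum_add diag_sum_mult diag_sum_diff
      using q(2) by (subst diag_sum_shift_rows) (auto simp: x_def)
    finally show ?thesis .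
  qed
  from replace[OF this] have "(\<Sum>i<m. (cmod (e (0, i)))\<^sup>2) \<le> (\<Sum>i<m. (cmod (h (0, i)))\<^sup>2)" .
  moreover have "(cmod (h (0, i)))\<^sup>2 = (cmod a)\<^sup>2 * (cmod (x (0, i)))\<^sup>2" "e (0, i) = x (0, i)" if "i < m" for i
    using hx[OF that, of 0] by (simp_all add: e_def shift_rows_def norm_mult power_mult_distrib)
  ultimately have "(\<Sum>i<m. (cmod (x (0, i)))\<^sup>2) \<le> (cmod a)\<^sup>2 * (\<Sum>i<m. (cmod (x (0, i)))\<^sup>2)"
    by (simp add: sum_distrib_left)
  then have "(1 - (cmod a)\<^sup>2) * (\<Sum>i<m. (cmod (x (0, i)))\<^sup>2) \<le> 0" by (simp add: algebra_simps)
  moreover have "1 - (cmod a)\<^sup>2 > 0" using a by (simp add: power_less_one_iff abs_square_less_1)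
  ultimately have "(\<Sum>i<m. (cmod (x (0, i)))\<^sup>2) \<le> 0" by (simp add: mult_le_0_iff)
  from vanish[OF this] have h0: "\<forall>i<m. h (0, i) = 0"
    using hx[of _ 0] by (simp add: shift_rows_def)
  \<comment> \<open>\<open>h(z) / z\<^sup>t\<close>, a polynomial once the first \<open>t\<close> coefficients of \<open>h\<close> vanish\<close>
  define e' where "e' t p = (if fst p + t \<le> N \<and> snd p < m then h (fst p + t, snd p) else 0)" for t p
  have "(\<forall>i<m. h (t, i) = 0) \<and> (\<forall>d i j. i < m \<longrightarrow> j < m \<longrightarrow>
      diag_sum N (\<lambda>p q. e' t p * cnj (e' t q)) d i j = diag_sum N (\<lambda>p q. h p * cnj (h q)) d i j)" if "t \<le> N" for t
    using that
  proof (induction t)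
    case 0
    show ?case using h0 by (auto intro!: diag_sum_cong simp: e'_def)
  next
    case (Suc t)
    then have IH: "\<And>i. i < m \<Longrightarrow> h (t, i) = 0" "\<And>d i j. i < m \<Longrightarrow> j < m \<Longrightarrow>
      diag_sum N (\<lambda>p q. e' t p * cnj (e' t q)) d i j = diag_sum N (\<lambda>p q. h p * cnj (h q)) d i j" by auto
    have shift: "e' t p = shift_rows (e' (Suc t)) p" for p
      using IH(1) by (cases p; cases "fst p") (auto simp: e'_def shift_rows_def)
    have eq: "diag_sum N (\<lambda>p q. e' (Suc t) p * cnj (e' (Suc t) q)) d i j = diag_sum N (\<lambda>p q. h p * cnj (h q)) d i j"
      if "i < m" "j < m" for d i j
      unfolding IH(2)[OF that, symmetric] shift by (rule diag_sum_shift_rows[symmetric]) (simp add: e'_def)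
    from replace[OF eq] have "(\<Sum>i<m. (cmod (e' (Suc t) (0, i)))\<^sup>2) \<le> 0"
      using h0 by simp
    from vanish[OF this] have "\<forall>i<m. h (Suc t, i) = 0"
      using Suc.prems by (simp add: e'_def)
    with eq show ?case by blast
  qed
  with s show ?thesis unfolding h_def by blast
qed


text \<open>
  After scaling \<open>u\<close> to a unit vector, a zero inside the disc makes the same combination of the columns vanish
  identically, which independent columns do not allow.
\<close>

lemma extremal_gram_factor_injective:
  assumes G: "G \<in> gram_set N m c"
    and max: "\<And>H. H \<in> gram_set N m c \<Longrightarrow> (\<Sum>i<m. Re (H (0, i) (0, i))) \<le> (\<Sum>i<m. Re (G (0, i) (0, i)))"
    and F: "\<And>p q. p \<in> block_index N m \<Longrightarrow> q \<in> block_index N m \<Longrightarrow> G p q = (\<Sum>r\<in>P. F r p * cnj (F r q))"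
    and P: "finite P"
    and indep: "\<forall>u. (\<forall>p\<in>block_index N m. (\<Sum>r\<in>P. u r * F r p) = 0) \<longrightarrow> (\<forall>r\<in>P. u r = 0)"
    and a: "cmod a < 1" and root: "\<And>i. i < m \<Longrightarrow> (\<Sum>s\<le>N. (\<Sum>r\<in>P. u r * F r (s, i)) * a ^ s) = 0"
    and r: "r \<in> P"
  shows "u r = 0"
proof (rule ccontr)
  assume "u r \<noteq> 0"
  define S where "S = (\<Sum>r\<in>P. (cmod (u r))\<^sup>2)"
  have "0 < (cmod (u r))\<^sup>2" using \<open>u r \<noteq> 0\<close> by simp
  also have "\<dots> \<le> S" unfolding S_def using P r by (intro member_le_sum) auto
  finally have S: "S > 0" .
  define w where "w r = of_real (1 / sqrt S) * u r" for r
  have "(\<Sum>r\<in>P. w r * cnj (w r)) = (\<Sum>r\<in>P. of_real (1 / S) * of_real ((cmod (u r))\<^sup>2))"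
  proof (intro sum.cong refl)
    fix r
    have "w r * cnj (w r) = of_real (1 / sqrt S * (1 / sqrt S)) * (u r * cnj (u r))"
      unfolding w_def complex_cnj_mult complex_cnj_complex_of_real of_real_mult by (simp only: mult_ac)
    also have "1 / sqrt S * (1 / sqrt S) = 1 / S" using S by simp
    finally show "w r * cnj (w r) = of_real (1 / S) * of_real ((cmod (u r))\<^sup>2)"
      by (simp only: complex_norm_square)
  qed
  also have "\<dots> = of_real (1 / S * S)"
    unfolding S_def by (simp only: of_real_mult of_real_sum sum_distrib_left)
  finally have w1: "(\<Sum>r\<in>P. w r * cnj (w r)) = 1" using S by simp
  have wsum: "(\<Sum>r\<in>P. w r * F r p) = of_real (1 / sqrt S) * (\<Sum>r\<in>P. u r * F r p)" for p
    unfolding w_def by (simp only: sum_distrib_left mult.assoc)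
  have root': "(\<Sum>s\<le>N. (\<Sum>r\<in>P. w r * F r (s, i)) * a ^ s) = 0" if "i < m" for i
    using root[OF that] unfolding wsum by (simp only: mult.assoc sum_distrib_left[symmetric] mult_zero_right)
  have "(\<Sum>r\<in>P. w r * F r (s, i)) = 0" if "s \<le> N" "i < m" for s i
    using G max F w1 a root' that by (rule extremal_gram_no_zero)
  then have "\<forall>r\<in>P. w r = 0"
    by (intro indep[THEN spec, THEN mp]) auto
  then show False using r \<open>u r \<noteq> 0\<close> S by (simp add: w_def)
qed

section \<open>Left-invertible matrices, rank and adjoints\<close>


lemma dim_mat_adjoint [simp]:
  "dim_row (mat_adjoint M) = dim_col M" "dim_col (mat_adjoint M) = dim_row M"
  unfolding mat_adjoint_def by auto

lemma mat_adjoint_carrier [simp]: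
  "mat_adjoint M \<in> carrier_mat n m \<longleftrightarrow> M \<in> carrier_mat m n"
  unfolding carrier_mat_def mem_Collect_eq dim_mat_adjoint by (rule conj_commute)

lemma mat_adjoint_index [simp]:
  fixes M :: "complex mat"
  assumes "i < dim_col M" "j < dim_row M"
  shows "mat_adjoint M $$ (i, j) = cnj (M $$ (j, i))"
  using assms unfolding mat_adjoint_def by (simp add: mat_of_rows_index)

lemma mat_adjoint_adjoint [simp]:
  fixes M :: "complex mat"
  shows "mat_adjoint (mat_adjoint M) = M"
  by (intro eq_matI) auto

lemma mat_adjoint_mult:
  fixes M :: "complex mat"
  assumes "M \<in> carrier_mat a b" "N \<in> carrier_mat b c"
  shows "mat_adjoint (M * N) = mat_adjoint N * mat_adjoint M"
  using assms by (intro eq_matI) (auto simp: scalar_prod_def mult.commute intro!: sum.cong)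

lemma mat_adjoint_smult:
  fixes M :: "complex mat"
  shows "mat_adjoint (c \<cdot>\<^sub>m M) = cnj c \<cdot>\<^sub>m mat_adjoint M"
  by (intro eq_matI) auto

lemma mat_adjoint_one [simp]: "mat_adjoint (1\<^sub>m n :: complex mat) = 1\<^sub>m n"
  by (intro eq_matI) auto

lemma adjoint_mult_vec_scalar_prod:
  fixes M :: "complex mat"
  assumes "M \<in> carrier_mat m k" "w \<in> carrier_vec m" "v \<in> carrier_vec k"
  shows "(mat_adjoint M *\<^sub>v w) \<bullet>c v = w \<bullet>c (M *\<^sub>v v)"
proof -
  have "(mat_adjoint M *\<^sub>v w) \<bullet>c v = (\<Sum>j<k. \<Sum>i<m. cnj (M $$ (i, j)) * w $ i * cnj (v $ j))"
    using assms by (simp add: scalar_prod_def sum_distrib_right atLeast0LessThan)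
  also have "\<dots> = (\<Sum>i<m. \<Sum>j<k. cnj (M $$ (i, j)) * w $ i * cnj (v $ j))"
    by (rule sum.swap)
  also have "\<dots> = w \<bullet>c (M *\<^sub>v v)"
    using assms by (simp add: scalar_prod_def sum_distrib_left atLeast0LessThan mult_ac)
  finally show ?thesis .
qed

text \<open>
  Injectivity in the form in which it is used: as the possibility to cancel a matrix factor.
\<close>

definition left_invertible :: "complex mat \<Rightarrow> bool" where
  "left_invertible M \<longleftrightarrow> (\<exists>L\<in>carrier_mat (dim_col M) (dim_row M). L * M = 1\<^sub>m (dim_col M))"

lemma left_invertibleE:
  assumes "left_invertible M" "M \<in> carrier_mat m k"
  obtains L where "L \<in> carrier_mat k m" "L * M = 1\<^sub>m k"
  using assms unfolding left_invertible_def by auto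

lemma left_invertible_cancel:
  assumes "left_invertible M" "M \<in> carrier_mat m k" "X \<in> carrier_mat k n" "Y \<in> carrier_mat k n"
    and "M * X = M * Y"
  shows "X = Y"
proof -
  obtain L where L: "L \<in> carrier_mat k m" "L * M = 1\<^sub>m k"
    using left_invertibleE[OF assms(1,2)] .
  have "X = L * M * X" using assms(3) by (simp add: L(2))
  also have "\<dots> = L * M * Y" using assms L(1) by simp
  also have "\<dots> = Y" using assms(4) by (simp add: L(2))
  finally show ?thesis .
qed

lemma adjoint_left_invertible_cancel:
  assumes "left_invertible M" "M \<in> carrier_mat m k" "X \<in> carrier_mat n k" "Y \<in> carrier_mat n k"
    and "X * mat_adjoint M = Y * mat_adjoint M"
  shows "X = Y"
proof -
  have adj: "mat_adjoint (Z * mat_adjoint M) = M * mat_adjoint Z" if "Z \<in> carrier_mat n k" for Z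
    using mat_adjoint_mult[OF that, of "mat_adjoint M" m] assms(2) by simp
  have "M * mat_adjoint X = mat_adjoint (X * mat_adjoint M)"
    by (rule adj[OF assms(3), symmetric])
  also have "\<dots> = M * mat_adjoint Y"
    unfolding assms(5) by (rule adj[OF assms(4)])
  finally have "mat_adjoint X = mat_adjoint Y"
    by (rule left_invertible_cancel[OF assms(1,2), rotated 2]) (use assms(3,4) in auto)
  then have "mat_adjoint (mat_adjoint X) = mat_adjoint (mat_adjoint Y)" by simp
  then show ?thesis by simp
qed

text \<open>
  An injective \<open>M\<close> has the left inverse \<open>(M\<^sup>* M)\<^sup>-\<^sup>1 M\<^sup>*\<close>.
\<close>

lemma left_invertible_iff_injective:
  assumes M: "M \<in> carrier_mat m k"
  shows "left_invertible M \<longleftrightarrow> (\<forall>v\<in>carrier_vec k. M *\<^sub>v v = 0\<^sub>v m \<longrightarrow> v = 0\<^sub>v k)"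
proof
  assume "left_invertible M"
  then obtain L where L: "L \<in> carrier_mat k m" "L * M = 1\<^sub>m k"
    using left_invertibleE M by blast
  show "\<forall>v\<in>carrier_vec k. M *\<^sub>v v = 0\<^sub>v m \<longrightarrow> v = 0\<^sub>v k"
  proof (intro ballI impI)
    fix v assume v: "v \<in> carrier_vec k" "M *\<^sub>v v = 0\<^sub>v m"
    have "v = (L * M) *\<^sub>v v" using v by (simp add: L)
    also have "\<dots> = L *\<^sub>v (M *\<^sub>v v)" by (rule assoc_mult_mat_vec[OF L(1) M v(1)])
    also have "\<dots> = 0\<^sub>v k" unfolding v(2) using L by auto
    finally show "v = 0\<^sub>v k" .
  qed
next
  assume inj: "\<forall>v\<in>carrier_vec k. M *\<^sub>v v = 0\<^sub>v m \<longrightarrow> v = 0\<^sub>v k"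
  let ?G = "mat_adjoint M * M"
  have G: "?G \<in> carrier_mat k k" using M by auto
  have "det ?G \<noteq> 0"
  proof
    assume "det ?G = 0"
    then obtain v where v: "v \<in> carrier_vec k" "v \<noteq> 0\<^sub>v k" "?G *\<^sub>v v = 0\<^sub>v k"
      using det_0_iff_vec_prod_zero_field[OF G] by auto
    have "(M *\<^sub>v v) \<bullet>c (M *\<^sub>v v) = (mat_adjoint M *\<^sub>v (M *\<^sub>v v)) \<bullet>c v"
      by (rule adjoint_mult_vec_scalar_prod[OF M _ v(1), symmetric]) (use M v in simp)
    also have "mat_adjoint M *\<^sub>v (M *\<^sub>v v) = ?G *\<^sub>v v"
      using M v by (intro assoc_mult_mat_vec[symmetric]) auto
    also have "(?G *\<^sub>v v) \<bullet>c v = 0" unfolding v(3) using v(1) by simp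
    finally have "M *\<^sub>v v = 0\<^sub>v m"
      using conjugate_square_eq_0_vec[of "M *\<^sub>v v" m] M v by auto
    with inj v show False by auto
  qed
  then have "(1 / det ?G) \<cdot>\<^sub>m adj_mat ?G * ?G = 1\<^sub>m k"
    using adj_mat[OF G] by (subst mult_smult_assoc_mat[OF _ G]) (auto intro!: eq_matI)
  then have "((1 / det ?G) \<cdot>\<^sub>m adj_mat ?G * mat_adjoint M) * M = 1\<^sub>m k"
    using M adj_mat[OF G] by (subst assoc_mult_mat[of _ k k _ m _ k]) auto
  then show "left_invertible M"
    unfolding left_invertible_def using M adj_mat[OF G] by (intro bexI) auto
qed

text \<open>
  The rank is defined through the set of columns, so repeated columns have to be excluded before linear
  independence of that set says anything about the matrix.
\<close>

lemma mat_rank_eq_ncols_iff: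
  assumes M: "M \<in> carrier_mat m k"
  shows "mat_rank m M = k \<longleftrightarrow> left_invertible M"
proof -
  interpret vec_space "TYPE(complex)" m .
  have "left_invertible M" if r: "rank M = k"
  proof -
    obtain S where S: "maximal S (\<lambda>T. T \<subseteq> set (cols M) \<and> lin_indpt T)"
      using maximal_exists_superset[of "set (cols M)" "\<lambda>T. T \<subseteq> set (cols M) \<and> lin_indpt T" "{}"]
        List.finite_set lin_dep_def by auto
    have "rank M = card S" by (rule rank_card_indpt[OF M S])
    moreover have "S \<subseteq> set (cols M)" using S by (auto simp: maximal_def)
    ultimately have "length (cols M) \<le> card (set (cols M))"
      using M r card_mono[of "set (cols M)" S] by auto
    then have dist: "distinct (cols M)"
      using card_length[of "cols M"] by (intro card_distinct) auto
    then have "lin_indpt (set (cols M))"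
      using full_rank_lin_indpt[OF M r] by auto
    then show ?thesis
      unfolding left_invertible_iff_injective[OF M] using lin_depI[OF M _ _ _ dist] by blast
  qed
  moreover have "rank M = k" if li: "left_invertible M"
  proof -
    have inj: "\<forall>v\<in>carrier_vec k. M *\<^sub>v v = 0\<^sub>v m \<longrightarrow> v = 0\<^sub>v k"
      using that left_invertible_iff_injective[OF M] by auto
    obtain L where L: "L \<in> carrier_mat k m" "L * M = 1\<^sub>m k"
      by (rule left_invertibleE[OF li M])
    have dist: "distinct (cols M)"
      unfolding distinct_conv_nth
    proof (intro allI impI notI)
      fix i j assume ij: "i < length (cols M)" "j < length (cols M)" "i \<noteq> j" "cols M ! i = cols M ! j"
      then have "col M i = col M j" and ij': "i < k" "j < k" using M by auto
      then have "col (L * M) i = col (L * M) j"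
        using col_mult2[OF L(1) M] by simp
      then have "col (1\<^sub>m k :: complex mat) i $ i = col (1\<^sub>m k :: complex mat) j $ i" unfolding L by simp
      with ij ij' show False by simp
    qed
    have "lin_indpt (set (cols M))"
      using lin_depE[OF M _ dist] inj by metis
    then show ?thesis using lin_indpt_full_rank[OF M dist] by auto
  qed
  ultimately show ?thesis by blast
qed

text \<open>
  The adjoint of \<open>M\<close> is surjective, so \<open>M\<close> and \<open>M M\<^sup>*\<close> have the same column space.
\<close>

lemma mat_rank_mult_adjoint:
  assumes M: "M \<in> carrier_mat m k" and "left_invertible M"
  shows "mat_rank m (M * mat_adjoint M) = k"
proof -
  interpret vec_space "TYPE(complex)" m .
  have MM: "M * mat_adjoint M \<in> carrier_mat m m" using M by auto
  obtain L where L: "L \<in> carrier_mat k m" "L * M = 1\<^sub>m k"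
    using left_invertibleE assms by blast
  have "mat_adjoint M * mat_adjoint L = 1\<^sub>m k"
    using mat_adjoint_mult[OF L(1) M] by (simp add: L(2))
  have "\<exists>x\<in>carrier_vec m. (M * mat_adjoint M) *\<^sub>v x = M *\<^sub>v v" if v: "v \<in> carrier_vec k" for v
  proof
    have "(M * mat_adjoint M) *\<^sub>v (mat_adjoint L *\<^sub>v v) = M *\<^sub>v (mat_adjoint M *\<^sub>v (mat_adjoint L *\<^sub>v v))"
      using M L v by (intro assoc_mult_mat_vec) auto
    also have "mat_adjoint M *\<^sub>v (mat_adjoint L *\<^sub>v v) = (mat_adjoint M * mat_adjoint L) *\<^sub>v v"
      using M L v by (intro assoc_mult_mat_vec[symmetric]) auto
    also have "\<dots> = v" using v \<open>mat_adjoint M * mat_adjoint L = 1\<^sub>m k\<close> by simp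
    finally show "(M * mat_adjoint M) *\<^sub>v (mat_adjoint L *\<^sub>v v) = M *\<^sub>v v" .
    show "mat_adjoint L *\<^sub>v v \<in> carrier_vec m"
      by (rule mult_mat_vec_carrier[OF _ v]) (use L in simp)
  qed
  moreover have "\<exists>v\<in>carrier_vec k. M *\<^sub>v v = (M * mat_adjoint M) *\<^sub>v x" if "x \<in> carrier_vec m" for x
    using M that by (intro bexI[of _ "mat_adjoint M *\<^sub>v x"]) auto
  ultimately have "col_space (M * mat_adjoint M) = col_space M"
    unfolding col_space_eq[OF MM] col_space_eq[OF M] using M by fastforce
  then have "rank (M * mat_adjoint M) = rank M"
    unfolding rank_def col_space_def by simp
  then show ?thesis using mat_rank_eq_ncols_iff[OF M] assms(2) by simp
qed

section \<open>Polynomial matrices with the same spectral function\<close>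

definition eval_mat :: "complex poly mat \<Rightarrow> complex \<Rightarrow> complex mat" where
  "eval_mat P z = map_mat (\<lambda>p. poly p z) P"

lemma eval_mat_carrier [simp]: "eval_mat P z \<in> carrier_mat m n \<longleftrightarrow> P \<in> carrier_mat m n"
  by (simp add: eval_mat_def)

lemma eval_mat_dim [simp]: "dim_row (eval_mat P z) = dim_row P" "dim_col (eval_mat P z) = dim_col P"
  by (auto simp: eval_mat_def)

lemma eval_mat_index [simp]:
  "i < dim_row P \<Longrightarrow> j < dim_col P \<Longrightarrow> eval_mat P z $$ (i, j) = poly (P $$ (i, j)) z"
  by (simp add: eval_mat_def)

lemma poly_eval_hom: "comm_ring_hom (\<lambda>p. poly p (z :: complex))" "semiring_hom (\<lambda>p. poly p (z :: complex))"
  by (unfold_locales; simp)+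

lemma eval_mat_mult:
  "P \<in> carrier_mat a b \<Longrightarrow> Q \<in> carrier_mat b c \<Longrightarrow> eval_mat (P * Q) z = eval_mat P z * eval_mat Q z"
  unfolding eval_mat_def by (rule semiring_hom.mat_hom_mult[OF poly_eval_hom(2)])

lemma eval_mat_smult: "eval_mat (p \<cdot>\<^sub>m P) z = poly p z \<cdot>\<^sub>m eval_mat P z"
  by (intro eq_matI) auto

lemma eval_mat_one: "eval_mat (1\<^sub>m k) z = 1\<^sub>m k"
  by (intro eq_matI) auto

lemma det_eval_mat: "det (eval_mat P z) = poly (det P) z"
  unfolding eval_mat_def by (rule comm_ring_hom.hom_det[OF poly_eval_hom(1)])

lemma poly_eq_if_cofinite:
  fixes p q :: "complex poly"
  assumes "finite F" "\<And>z. z \<notin> F \<Longrightarrow> poly p z = poly q z"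
  shows "p = q"
proof (rule ccontr)
  assume "p \<noteq> q"
  then have "finite {z. poly (p - q) z = 0}" by (intro poly_roots_finite) simp
  moreover have "UNIV \<subseteq> F \<union> {z. poly (p - q) z = 0}" using assms(2) by auto
  ultimately show False using assms(1) infinite_UNIV_char_0 finite_subset by (metis finite_Un)
qed

lemma eval_mat_eq_if_cofinite:
  assumes "finite F" "P \<in> carrier_mat m n" "Q \<in> carrier_mat m n"
    and "\<And>z. z \<notin> F \<Longrightarrow> eval_mat P z = eval_mat Q z"
  shows "P = Q"
proof (intro eq_matI)
  fix i j assume ij: "i < dim_row Q" "j < dim_col Q"
  show "P $$ (i, j) = Q $$ (i, j)"
  proof (rule poly_eq_if_cofinite[OF assms(1)])
    fix z assume "z \<notin> F"
    then have "eval_mat P z $$ (i, j) = eval_mat Q z $$ (i, j)" using assms(4) by simp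
    then show "poly (P $$ (i, j)) z = poly (Q $$ (i, j)) z" using ij assms(2,3) by simp
  qed
qed (use assms in auto)

text \<open>
  With a fixed left inverse \<open>L\<close> of \<open>P(a)\<close>, the polynomial \<open>det (L P(z))\<close> is \<open>1\<close> at \<open>a\<close>, and \<open>P(z)\<close> is injective
  wherever it does not vanish.
\<close>

lemma finite_not_left_invertible:
  assumes P: "P \<in> carrier_mat m k" and "left_invertible (eval_mat P a)"
  shows "finite {z. \<not> left_invertible (eval_mat P z)}"
proof -
  obtain L where L: "L \<in> carrier_mat k m" "L * eval_mat P a = 1\<^sub>m k"
    by (rule left_invertibleE[OF assms(2)]) (use P in simp)
  define L' where "L' = map_mat (\<lambda>c. [:c:]) L"
  have L': "L' \<in> carrier_mat k m" "\<And>z. eval_mat L' z = L"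
    using L(1) by (auto simp: L'_def intro!: eq_matI)
  define d where "d = det (L' * P)"
  have d: "poly d z = det (L * eval_mat P z)" for z
    unfolding d_def det_eval_mat[symmetric] using L' P by (simp add: eval_mat_mult)
  have "poly d a = 1" by (simp add: d L)
  then have fin: "finite {z. poly d z = 0}" by (intro poly_roots_finite) auto
  have "left_invertible (eval_mat P z)" if "poly d z \<noteq> 0" for z
    unfolding left_invertible_iff_injective[OF eval_mat_carrier[THEN iffD2, OF P]]
  proof (intro ballI impI)
    fix v assume v: "v \<in> carrier_vec k" "eval_mat P z *\<^sub>v v = 0\<^sub>v m"
    have LP: "L * eval_mat P z \<in> carrier_mat k k" using L P by auto
    have "(L * eval_mat P z) *\<^sub>v v = L *\<^sub>v (eval_mat P z *\<^sub>v v)"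
      by (rule assoc_mult_mat_vec[OF L(1) _ v(1)]) (use P in simp)
    also have "\<dots> = 0\<^sub>v k" unfolding v(2) using L(1) by auto
    finally show "v = 0\<^sub>v k"
      using that det_0_iff_vec_prod_zero_field[OF LP] v(1) unfolding d by blast
  qed
  then have "{z. \<not> left_invertible (eval_mat P z)} \<subseteq> {z. poly d z = 0}" by auto
  then show ?thesis using fin by (rule finite_subset)
qed

text \<open>
  If \<open>B = A X\<close> and \<open>L A\<close> is square, then \<open>A adj(L A) L B = A adj(L A) (L A) X = det (L A) A X\<close>: Cramer's rule
  clears the denominators of the rational matrix \<open>X\<close>.
\<close>

lemma ex_polynomial_transition:
  assumes A: "A \<in> carrier_mat m k" and B: "B \<in> carrier_mat m k" and li: "left_invertible (eval_mat A a)"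
    and "finite F" and "\<And>z. z \<notin> F \<Longrightarrow> \<exists>X\<in>carrier_mat k k. eval_mat B z = eval_mat A z * X"
  shows "\<exists>d W. d \<noteq> 0 \<and> W \<in> carrier_mat k k \<and> A * W = d \<cdot>\<^sub>m B"
proof -
  obtain L where L: "L \<in> carrier_mat k m" "L * eval_mat A a = 1\<^sub>m k"
    by (rule left_invertibleE[OF li]) (use A in simp)
  define L' where "L' = map_mat (\<lambda>c. [:c:]) L"
  have L': "L' \<in> carrier_mat k m" "\<And>z. eval_mat L' z = L"
    using L(1) by (auto simp: L'_def intro!: eq_matI)
  define G where "G = L' * A"
  have G: "G \<in> carrier_mat k k" using L' A by (auto simp: G_def)
  define W where "W = adj_mat G * (L' * B)"
  have W: "W \<in> carrier_mat k k" using adj_mat[OF G] L' B by (auto simp: W_def)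
  have "poly (det G) a = 1"
    unfolding det_eval_mat[symmetric] G_def using L' A by (simp add: eval_mat_mult L)
  then have "det G \<noteq> 0" by auto
  moreover have "A * W = det G \<cdot>\<^sub>m B"
  proof (rule eval_mat_eq_if_cofinite[OF assms(4)])
    show "A * W \<in> carrier_mat m k" "det G \<cdot>\<^sub>m B \<in> carrier_mat m k" using A B W by auto
    fix z assume "z \<notin> F"
    then obtain X where X: "X \<in> carrier_mat k k" "eval_mat B z = eval_mat A z * X"
      using assms(5) by auto
    let ?A = "eval_mat A z" and ?N = "eval_mat (adj_mat G) z"
    have N: "?N \<in> carrier_mat k k" and Ac: "?A \<in> carrier_mat m k" using adj_mat[OF G] A by auto
    have "?N * (L * ?A) = ?N * eval_mat G z"
      unfolding G_def eval_mat_mult[OF L'(1) A] L'(2) by (rule refl)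
    also have "\<dots> = eval_mat (adj_mat G * G) z"
      by (rule eval_mat_mult[OF adj_mat(1)[OF G] G, symmetric])
    also have "\<dots> = poly (det G) z \<cdot>\<^sub>m 1\<^sub>m k"
      unfolding adj_mat(3)[OF G] eval_mat_smult by (auto intro!: eq_matI)
    finally have NG: "?N * (L * ?A) = poly (det G) z \<cdot>\<^sub>m 1\<^sub>m k" .
    have "eval_mat (A * W) z = ?A * (?N * (L * (?A * X)))"
      unfolding W_def eval_mat_mult[OF A W[unfolded W_def]] X(2)[symmetric]
        eval_mat_mult[OF adj_mat(1)[OF G] mult_carrier_mat[OF L'(1) B]] eval_mat_mult[OF L'(1) B] L'(2)
      by (rule refl)
    also have "L * (?A * X) = (L * ?A) * X" using L(1) Ac X by (intro assoc_mult_mat[symmetric])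
    also have "?N * (L * ?A * X) = (?N * (L * ?A)) * X" using L(1) Ac X N by (intro assoc_mult_mat[symmetric]) auto
    also have "\<dots> = poly (det G) z \<cdot>\<^sub>m X" unfolding NG mult_smult_assoc_mat[OF one_carrier_mat X(1)] left_mult_one_mat[OF X(1)] ..
    also have "?A * (poly (det G) z \<cdot>\<^sub>m X) = poly (det G) z \<cdot>\<^sub>m (?A * X)"
      using Ac X by (intro mult_smult_distrib)
    finally show "eval_mat (A * W) z = eval_mat (det G \<cdot>\<^sub>m B) z"
      by (simp add: eval_mat_smult X)
  qed
  ultimately show ?thesis using W by blast
qed

lemma divide_out_root:
  assumes W: "W \<in> carrier_mat k n" and "eval_mat W a = 0\<^sub>m k n"
  obtains V where "V \<in> carrier_mat k n" "W = [:-a, 1:] \<cdot>\<^sub>m V"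
proof -
  have "[:-a, 1:] dvd W $$ (i, j)" if "i < k" "j < n" for i j
  proof -
    have "eval_mat W a $$ (i, j) = 0" using that assms by simp
    then show ?thesis using that W by (simp add: poly_eq_0_iff_dvd)
  qed
  then have "\<exists>q. W $$ (i, j) = [:-a, 1:] * q" if "i < k" "j < n" for i j
    using that by (auto simp: dvd_def)
  then obtain q where q: "\<And>i j. i < k \<Longrightarrow> j < n \<Longrightarrow> W $$ (i, j) = [:-a, 1:] * q i j" by metis
  show ?thesis
    using W q by (intro that[of "mat k n (\<lambda>(i, j). q i j)"] eq_matI) auto
qed

lemma continuous_eq_if_cofinite:
  fixes f g :: "complex \<Rightarrow> complex"
  assumes "continuous_on (- {0}) f" "continuous_on (- {0}) g" "finite F"
    and "\<And>z. z \<notin> F \<Longrightarrow> f z = g z" and "z \<noteq> 0"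
  shows "f z = g z"
proof (rule tendsto_unique[of "at z"])
  have o: "open (- {0 :: complex})" by (intro open_Compl closed_singleton)
  have "(f \<longlongrightarrow> f z) (at z)" and g: "(g \<longlongrightarrow> g z) (at z)"
    using assms(1,2,5) continuous_on_eq_continuous_at[OF o] by (auto simp: isCont_def)
  have "eventually (\<lambda>w. w \<notin> F) (at z)"
    unfolding eventually_at_topological
  proof (intro exI[of _ "- (F - {z})"] conjI)
    show "open (- (F - {z}))"
      using assms(3) by (intro open_Compl finite_imp_closed) (rule finite_Diff)
  qed auto
  then have "eventually (\<lambda>w. f w = g w) (at z)"
    by eventually_elim (rule assms(4))
  then show "(f \<longlongrightarrow> g z) (at z)"
    using g by (simp add: tendsto_cong)
  show "(f \<longlongrightarrow> f z) (at z)" by fact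
qed simp

lemma continuous_on_mult_adjoint_index:
  assumes "P \<in> carrier_mat a b" "Q \<in> carrier_mat c b" "i < a" "j < c"
  shows "continuous_on (- {0}) (\<lambda>z. (eval_mat P z * mat_adjoint (eval_mat Q (1 / cnj z))) $$ (i, j))"
proof -
  have "(\<lambda>z. (eval_mat P z * mat_adjoint (eval_mat Q (1 / cnj z))) $$ (i, j))
      = (\<lambda>z. \<Sum>l<b. poly (P $$ (i, l)) z * cnj (poly (Q $$ (j, l)) (1 / cnj z)))"
    using assms by (auto simp: scalar_prod_def atLeast0LessThan)
  then show ?thesis by (simp only:) (auto intro!: continuous_intros)
qed



text \<open>
  Extends an identity \<open>P Q\<^sup>~ = f R\<close>, obtained by cancellation at generic points, to the exceptional ones.
\<close>

lemma mult_adjoint_eq_if_cofinite: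
  assumes "P \<in> carrier_mat a b" "Q \<in> carrier_mat c b" "R \<in> carrier_mat a c" "finite F" "z \<noteq> 0"
    and "continuous_on (- {0}) f"
    and "\<And>z. z \<notin> F \<Longrightarrow> eval_mat P z * mat_adjoint (eval_mat Q (1 / cnj z)) = f z \<cdot>\<^sub>m eval_mat R z"
  shows "eval_mat P z * mat_adjoint (eval_mat Q (1 / cnj z)) = f z \<cdot>\<^sub>m eval_mat R z"
proof (rule eq_matI)
  fix i j assume "i < dim_row (f z \<cdot>\<^sub>m eval_mat R z)" "j < dim_col (f z \<cdot>\<^sub>m eval_mat R z)"
  then have ij: "i < a" "j < c" using assms(3) by auto
  have "(eval_mat P z * mat_adjoint (eval_mat Q (1 / cnj z))) $$ (i, j) = f z * poly (R $$ (i, j)) z"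
  proof (rule continuous_eq_if_cofinite[OF _ _ assms(4) _ assms(5)])
    show "continuous_on (- {0}) (\<lambda>z. (eval_mat P z * mat_adjoint (eval_mat Q (1 / cnj z))) $$ (i, j))"
      by (rule continuous_on_mult_adjoint_index[OF assms(1,2) ij])
    show "continuous_on (- {0}) (\<lambda>z. f z * poly (R $$ (i, j)) z)"
      by (intro continuous_intros assms(6))
    fix w assume "w \<notin> F"
    show "(eval_mat P w * mat_adjoint (eval_mat Q (1 / cnj w))) $$ (i, j) = f w * poly (R $$ (i, j)) w"
      unfolding assms(7)[OF \<open>w \<notin> F\<close>] using ij assms(3) by simp
  qed
  then show "(eval_mat P z * mat_adjoint (eval_mat Q (1 / cnj z))) $$ (i, j) = (f z \<cdot>\<^sub>m eval_mat R z) $$ (i, j)"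
    using ij assms(3) by simp
qed (use assms(1-3) in auto)

lemma smult_mat_cancel:
  fixes M :: "complex mat"
  assumes "M \<in> carrier_mat a b" "M' \<in> carrier_mat a b" "c \<cdot>\<^sub>m M = c \<cdot>\<^sub>m M'" "c \<noteq> 0"
  shows "M = M'"
proof (intro eq_matI)
  fix i j assume ij: "i < dim_row M'" "j < dim_col M'"
  then have "(c \<cdot>\<^sub>m M) $$ (i, j) = (c \<cdot>\<^sub>m M') $$ (i, j)" using assms(3) by simp
  then show "M $$ (i, j) = M' $$ (i, j)" using ij assms(1,2,4) by simp
qed (use assms in auto)

lemma mult_mat_adjoint_self_eq_zero:
  fixes M :: "complex mat"
  assumes M: "M \<in> carrier_mat a b" and "M * mat_adjoint M = 0\<^sub>m a a"
  shows "M = 0\<^sub>m a b"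
proof (intro eq_matI)
  fix i j assume ij: "i < dim_row (0\<^sub>m a b :: complex mat)" "j < dim_col (0\<^sub>m a b :: complex mat)"
  have "0 = (M * mat_adjoint M) $$ (i, i)" using assms(2) ij by simp
  also have "\<dots> = (\<Sum>l<b. M $$ (i, l) * cnj (M $$ (i, l)))"
    using M ij by (simp add: scalar_prod_def atLeast0LessThan)
  also have "\<dots> = (\<Sum>l<b. of_real ((cmod (M $$ (i, l)))\<^sup>2))"
    by (simp only: complex_norm_square)
  finally have "(\<Sum>l<b. (cmod (M $$ (i, l)))\<^sup>2) = 0"
    by (metis of_real_eq_0_iff of_real_sum)
  then have "(cmod (M $$ (i, j)))\<^sup>2 = 0"
    using ij by (subst (asm) sum_nonneg_eq_0_iff) auto
  then show "M $$ (i, j) = 0\<^sub>m a b $$ (i, j)" using ij by simp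
qed (use M in auto)


lemma poly_eq_sum_upto:
  fixes p :: "'a :: comm_semiring_1 poly"
  assumes "degree p \<le> n"
  shows "poly p x = (\<Sum>l\<le>n. coeff p l * x ^ l)"
  unfolding poly_altdef using assms by (intro sum.mono_neutral_left) (auto simp: coeff_eq_0)

text \<open>
  Let \<open>n\<close> be the largest degree in \<open>W\<close>. Then \<open>R(z) = z\<^sup>n W\<^sup>~(z)\<close> is a polynomial matrix whose value at \<open>0\<close> is the
  adjoint of the coefficient of \<open>z\<^sup>n\<close> in \<open>W\<close>, and \<open>B R = c z\<^sup>n A\<close>. If \<open>n > 0\<close>, evaluation at \<open>0\<close> shows
  that this coefficient is zero.
\<close>

lemma const_mat_if_adjoint_bounded_at_0:
  assumes A: "A \<in> carrier_mat m k" and B: "B \<in> carrier_mat m k" and W: "W \<in> carrier_mat k k"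
    and li: "left_invertible (eval_mat B 0)"
    and eq: "\<And>z. z \<noteq> 0 \<Longrightarrow> eval_mat B z * mat_adjoint (eval_mat W (1 / cnj z)) = c \<cdot>\<^sub>m eval_mat A z"
  shows "eval_mat W z = eval_mat W 0"
proof -
  define n where "n = Max (insert 0 ((\<lambda>(i, j). degree (W $$ (i, j))) ` ({..<k} \<times> {..<k})))"
  have deg: "degree (W $$ (i, j)) \<le> n" if "i < k" "j < k" for i j
    unfolding n_def using that by (intro Max_ge) auto
  define R where "R = mat k k (\<lambda>(i, j). \<Sum>l\<le>n. monom (cnj (coeff (W $$ (j, i)) l)) (n - l))"
  have R: "R \<in> carrier_mat k k" by (simp add: R_def)
  have Rz: "eval_mat R z = z ^ n \<cdot>\<^sub>m mat_adjoint (eval_mat W (1 / cnj z))" if "z \<noteq> 0" for z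
  proof (intro eq_matI)
    fix i j
    assume "i < dim_row (z ^ n \<cdot>\<^sub>m mat_adjoint (eval_mat W (1 / cnj z)))"
      "j < dim_col (z ^ n \<cdot>\<^sub>m mat_adjoint (eval_mat W (1 / cnj z)))"
    then have ij: "i < k" "j < k" using W by auto
    have "eval_mat R z $$ (i, j) = (\<Sum>l\<le>n. cnj (coeff (W $$ (j, i)) l) * z ^ (n - l))"
      using ij R by (simp add: R_def poly_sum poly_monom)
    also have "\<dots> = (\<Sum>l\<le>n. z ^ n * (cnj (coeff (W $$ (j, i)) l) * (1 / z) ^ l))"
      using that by (intro sum.cong refl) (simp add: power_diff power_divide)
    also have "\<dots> = z ^ n * cnj (poly (W $$ (j, i)) (1 / cnj z))"
      using ij by (simp add: poly_eq_sum_upto[OF deg] sum_distrib_left)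
    finally show "eval_mat R z $$ (i, j) = (z ^ n \<cdot>\<^sub>m mat_adjoint (eval_mat W (1 / cnj z))) $$ (i, j)"
      using ij W by simp
  qed (use R W in auto)
  have BR: "B * R = monom c n \<cdot>\<^sub>m A"
  proof (rule eval_mat_eq_if_cofinite[of "{0}"])
    fix z :: complex assume "z \<notin> {0}"
    then have z: "z \<noteq> 0" by simp
    have "eval_mat (B * R) z = eval_mat B z * (z ^ n \<cdot>\<^sub>m mat_adjoint (eval_mat W (1 / cnj z)))"
      unfolding eval_mat_mult[OF B R] Rz[OF z] ..
    also have "\<dots> = z ^ n \<cdot>\<^sub>m (eval_mat B z * mat_adjoint (eval_mat W (1 / cnj z)))"
      by (rule mult_smult_distrib[of _ m k _ k]) (use B W in auto)
    also have "\<dots> = eval_mat (monom c n \<cdot>\<^sub>m A) z"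
      unfolding eq[OF z] eval_mat_smult poly_monom by (auto intro!: eq_matI)
    finally show "eval_mat (B * R) z = eval_mat (monom c n \<cdot>\<^sub>m A) z" .
  qed (use A B R in auto)
  have "n = 0"
  proof (rule ccontr)
    assume "n \<noteq> 0"
    then have "eval_mat B 0 * eval_mat R 0 = eval_mat B 0 * 0\<^sub>m k k"
      using arg_cong[OF BR, of "\<lambda>P. eval_mat P 0"] A B
      by (auto simp: eval_mat_mult[OF B R] eval_mat_smult poly_monom power_0_left intro!: eq_matI)
    then have R0: "eval_mat R 0 = 0\<^sub>m k k"
      by (rule left_invertible_cancel[OF li, rotated 3]) (use B R in auto)
    have lead: "coeff (W $$ (j, i)) n = 0" if ij: "i < k" "j < k" for i j
    proof -
      have "0 = eval_mat R 0 $$ (i, j)" using R0 ij by simp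
      also have "\<dots> = (\<Sum>l\<le>n. cnj (coeff (W $$ (j, i)) l) * 0 ^ (n - l))"
        using ij R by (simp add: R_def poly_sum poly_monom)
      also have "\<dots> = (\<Sum>l\<in>{n}. cnj (coeff (W $$ (j, i)) l) * 0 ^ (n - l))"
        by (rule sum.mono_neutral_right) auto
      finally show ?thesis by simp
    qed
    have "n \<in> insert 0 ((\<lambda>(i, j). degree (W $$ (i, j))) ` ({..<k} \<times> {..<k}))"
      unfolding n_def by (rule Max_in) auto
    then obtain i j where "i < k" "j < k" "degree (W $$ (i, j)) = n"
      using \<open>n \<noteq> 0\<close> by auto
    with lead[of j i] \<open>n \<noteq> 0\<close> show False by (metis degree_0 leading_coeff_0_iff)
  qed
  show ?thesis
  proof (intro eq_matI)
    fix i j assume "i < dim_row (eval_mat W 0)" "j < dim_col (eval_mat W 0)"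
    then have ij: "i < k" "j < k" using W by auto
    have "poly (W $$ (i, j)) x = coeff (W $$ (i, j)) 0" for x
      using deg[OF ij] \<open>n = 0\<close> by (subst poly_eq_sum_upto[of _ 0]) auto
    then show "eval_mat W z $$ (i, j) = eval_mat W 0 $$ (i, j)" using ij W by simp
  qed (use W in auto)
qed

text \<open>
  The pair \<open>(d, W)\<close> with \<open>A W = d B\<close> is chosen with \<open>d\<close> of least degree. Every zero of \<open>d\<close> would also be a zero of
  \<open>W\<close>, contradicting this choice.
\<close>

lemma unitary_transition:
  assumes A: "A \<in> carrier_mat m k" and B: "B \<in> carrier_mat m k"
    and liA: "\<And>z. cmod z < 1 \<Longrightarrow> left_invertible (eval_mat A z)"
    and liB: "\<And>z. cmod z < 1 \<Longrightarrow> left_invertible (eval_mat B z)"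
    and eq: "\<And>z. z \<noteq> 0 \<Longrightarrow> eval_mat A z * mat_adjoint (eval_mat A (1 / cnj z))
                          = eval_mat B z * mat_adjoint (eval_mat B (1 / cnj z))"
  shows "\<exists>U. unitary_mat k U \<and> (\<forall>z. eval_mat B z = eval_mat A z * U)"
proof -
  let ?A = "eval_mat A" and ?B = "eval_mat B"
  let ?r = "\<lambda>z :: complex. 1 / cnj z"
  have Ac: "?A z \<in> carrier_mat m k" and Bc: "?B z \<in> carrier_mat m k" for z using A B by auto
  define E where "E = {z. \<not> left_invertible (?A z)} \<union> {z. \<not> left_invertible (?B z)}"
  \<comment> \<open>outside \<open>F\<close> both \<open>A\<close>, \<open>B\<close> and their reflections can be cancelled\<close>
  define F where "F = {0} \<union> E \<union> ?r ` E"
  have "finite E"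
    unfolding E_def using finite_not_left_invertible[OF A liA[of 0]] finite_not_left_invertible[OF B liB[of 0]]
    by simp
  then have F: "finite F" by (simp add: F_def)
  have rr: "?r (?r z) = z" for z by simp
  have nF: "z \<noteq> 0" "left_invertible (?A z)" "left_invertible (?B z)"
    "left_invertible (?A (?r z))" "left_invertible (?B (?r z))" if "z \<notin> F" for z
  proof -
    have "?r z \<notin> E"
    proof
      assume "?r z \<in> E"
      then have "?r (?r z) \<in> ?r ` E" by (rule imageI)
      with that show False unfolding rr F_def by blast
    qed
    with that show "z \<noteq> 0" "left_invertible (?A z)" "left_invertible (?B z)"
      "left_invertible (?A (?r z))" "left_invertible (?B (?r z))" by (auto simp: F_def E_def)
  qed
  \<comment> \<open>the admissible pairs \<open>(d, W)\<close>, among which \<open>d\<close> of least degree is taken\<close>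
  define T where "T = (\<lambda>(d :: complex poly, W). d \<noteq> 0 \<and> W \<in> carrier_mat k k \<and> A * W = d \<cdot>\<^sub>m B)"
  have "\<exists>X\<in>carrier_mat k k. ?B z = ?A z * X" if z: "z \<notin> F" for z
  proof -
    obtain L where L: "L \<in> carrier_mat k m" "L * ?B (?r z) = 1\<^sub>m k"
      by (rule left_invertibleE[OF nF(5)[OF z] Bc])
    have 1: "mat_adjoint (?B (?r z)) * mat_adjoint L = 1\<^sub>m k"
      unfolding mat_adjoint_mult[OF L(1) Bc[of "?r z"], symmetric] L(2) by simp
    have "?B z = ?B z * (mat_adjoint (?B (?r z)) * mat_adjoint L)"
      unfolding 1 by (rule right_mult_one_mat[OF Bc, symmetric])
    also have "\<dots> = (?B z * mat_adjoint (?B (?r z))) * mat_adjoint L"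
      by (rule assoc_mult_mat[of _ m k _ m _ k, symmetric]) (use B L in auto)
    also have "\<dots> = (?A z * mat_adjoint (?A (?r z))) * mat_adjoint L"
      unfolding eq[OF nF(1)[OF z]] ..
    also have "\<dots> = ?A z * (mat_adjoint (?A (?r z)) * mat_adjoint L)"
      by (rule assoc_mult_mat[of _ m k _ m _ k]) (use A L in auto)
    finally show ?thesis
      by (rule bexI) (rule mult_carrier_mat[of _ k m], use A L in auto)
  qed
  then have "\<exists>x. T x"
    using ex_polynomial_transition[OF A B liA[of 0] F] unfolding T_def by auto
  then obtain x where x: "T x" "\<And>y. T y \<Longrightarrow> degree (fst x) \<le> degree (fst y)"
    using ex_has_least_nat[of T _ "\<lambda>x. degree (fst x)"] by blast
  obtain d W where dW: "x = (d, W)" by (cases x)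
  have d: "d \<noteq> 0" and W: "W \<in> carrier_mat k k" and AW: "A * W = d \<cdot>\<^sub>m B"
    using x(1) unfolding T_def dW by auto
  let ?W = "eval_mat W"
  have Wc: "?W z \<in> carrier_mat k k" for z using W by simp
  have AWz: "?A z * ?W z = poly d z \<cdot>\<^sub>m ?B z" for z
    unfolding eval_mat_mult[OF A W, symmetric] AW eval_mat_smult ..
  have WW0: "?W z * mat_adjoint (?W (?r z)) = (poly d z * cnj (poly d (?r z))) \<cdot>\<^sub>m 1\<^sub>m k" if z: "z \<notin> F" for z
  proof -
    let ?c = "poly d z * cnj (poly d (?r z))"
    let ?w = "?r z"
    have c: "mat_adjoint (?A ?w) \<in> carrier_mat k m" "mat_adjoint (?B ?w) \<in> carrier_mat k m"
      "mat_adjoint (?W ?w) \<in> carrier_mat k k" using Ac Bc Wc by simp_all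
    have "?A z * (?W z * mat_adjoint (?W ?w)) * mat_adjoint (?A ?w)
        = (?A z * ?W z) * mat_adjoint (?A ?w * ?W ?w)"
      unfolding mat_adjoint_mult[OF Ac[of ?w] Wc[of ?w]]
      by (simp only: assoc_mult_mat[OF Ac mult_carrier_mat[OF Wc c(3)] c(1)] assoc_mult_mat[OF Wc c(3) c(1)]
          assoc_mult_mat[OF Ac Wc mult_carrier_mat[OF c(3) c(1)]])
    also have "\<dots> = (poly d z \<cdot>\<^sub>m ?B z) * (cnj (poly d ?w) \<cdot>\<^sub>m mat_adjoint (?B ?w))"
      unfolding AWz mat_adjoint_smult ..
    also have "\<dots> = ?c \<cdot>\<^sub>m (?B z * mat_adjoint (?B ?w))"
      unfolding mult_smult_distrib[OF smult_carrier_mat[OF Bc] c(2)] mult_smult_assoc_mat[OF Bc c(2)]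
      by (auto intro!: eq_matI)
    also have "\<dots> = ?c \<cdot>\<^sub>m (?A z * mat_adjoint (?A ?w))"
      unfolding eq[OF nF(1)[OF z]] ..
    also have "\<dots> = (?A z * (?c \<cdot>\<^sub>m 1\<^sub>m k)) * mat_adjoint (?A ?w)"
      unfolding mult_smult_distrib[OF Ac one_carrier_mat] right_mult_one_mat[OF Ac] mult_smult_assoc_mat[OF Ac c(1)] ..
    finally have "?A z * (?W z * mat_adjoint (?W ?w)) = ?A z * (?c \<cdot>\<^sub>m 1\<^sub>m k)"
      by (rule adjoint_left_invertible_cancel[OF nF(4)[OF z] Ac, rotated 2]) (use Ac[of z] Wc[of z] c in auto)
    then show ?thesis
      by (rule left_invertible_cancel[OF nF(2)[OF z] Ac, rotated 2]) (use Wc[of z] c in auto)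
  qed
  have cont: "continuous_on (- {0}) (\<lambda>z. poly p (?r z))" for p
    by (intro continuous_intros) auto
  have WW: "?W z * mat_adjoint (?W (?r z)) = (poly d z * cnj (poly d (?r z))) \<cdot>\<^sub>m 1\<^sub>m k" if "z \<noteq> 0" for z
  proof -
    have "?W z * mat_adjoint (?W (?r z)) = (poly d z * cnj (poly d (?r z))) \<cdot>\<^sub>m eval_mat (1\<^sub>m k) z"
    proof (rule mult_adjoint_eq_if_cofinite[OF W W one_carrier_mat F that])
      show "continuous_on (- {0}) (\<lambda>z. poly d z * cnj (poly d (?r z)))"
        by (intro continuous_intros cont)
    qed (simp add: WW0 eval_mat_one)
    then show ?thesis by (simp add: eval_mat_one)
  qed
  have BW: "?B z * mat_adjoint (?W (?r z)) = cnj (poly d (?r z)) \<cdot>\<^sub>m ?A z" if "z \<noteq> 0" for z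
  proof (rule mult_adjoint_eq_if_cofinite[OF B W A _ that])
    show "finite (F \<union> {z. poly d z = 0})" using F d poly_roots_finite by simp
    show "continuous_on (- {0}) (\<lambda>z. cnj (poly d (?r z)))" by (intro continuous_intros cont)
    fix z assume "z \<notin> F \<union> {z. poly d z = 0}"
    then have z: "z \<notin> F" and dz: "poly d z \<noteq> 0" by auto
    have c: "mat_adjoint (?W (?r z)) \<in> carrier_mat k k" using Wc by simp
    have "poly d z \<cdot>\<^sub>m (?B z * mat_adjoint (?W (?r z))) = ?A z * (?W z * mat_adjoint (?W (?r z)))"
      unfolding mult_smult_assoc_mat[OF Bc c, symmetric] AWz[symmetric] by (rule assoc_mult_mat[OF Ac Wc c])
    also have "\<dots> = poly d z \<cdot>\<^sub>m (cnj (poly d (?r z)) \<cdot>\<^sub>m ?A z)"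
      unfolding WW0[OF z] mult_smult_distrib[OF Ac one_carrier_mat] right_mult_one_mat[OF Ac] by (auto intro!: eq_matI)
    finally show "?B z * mat_adjoint (?W (?r z)) = cnj (poly d (?r z)) \<cdot>\<^sub>m ?A z"
      by (rule smult_mat_cancel[rotated 2]) (use dz A B W in auto)
  qed
  have W_root: "?W a = 0\<^sub>m k k" if root: "poly d a = 0" for a
  proof -
    consider "cmod a < 1" | "cmod a = 1" | "cmod a > 1" by linarith
    \<comment> \<open>inside the circle \<open>A W = d B\<close> applies, on it \<open>W W\<^sup>~ = d d\<^sup>~\<close>, outside \<open>B W\<^sup>~ = d\<^sup>~ A\<close> at the reflected point\<close>
    then show ?thesis
    proof cases
      case 1
      have "?A a * ?W a = ?A a * 0\<^sub>m k k"
        unfolding AWz root using A B by (auto intro!: eq_matI)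
      then show ?thesis by (rule left_invertible_cancel[OF liA[OF 1] Ac, rotated 2]) (use W in auto)
    next
      case 2
      then have "a * cnj a = 1" by (simp add: complex_norm_square[symmetric])
      then have a: "?r a = a" "a \<noteq> 0" by (auto simp: divide_eq_eq)
      have "?W a * mat_adjoint (?W a) = 0\<^sub>m k k"
        using WW[OF a(2)] unfolding a(1) root by (auto intro!: eq_matI)
      then show ?thesis by (rule mult_mat_adjoint_self_eq_zero[OF Wc])
    next
      case 3
      then have z: "cmod (?r a) < 1" "?r a \<noteq> 0" by (auto simp: norm_divide divide_less_eq)
      have "?B (?r a) * mat_adjoint (?W a) = ?B (?r a) * 0\<^sub>m k k"
        using BW[OF z(2)] unfolding rr root using A B by (auto intro!: eq_matI)
      then have "mat_adjoint (?W a) = 0\<^sub>m k k"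
        by (rule left_invertible_cancel[OF liB[OF z(1)] Bc, rotated 2]) (use W in auto)
      then have "mat_adjoint (mat_adjoint (?W a)) = mat_adjoint (0\<^sub>m k k)" by simp
      also have "\<dots> = 0\<^sub>m k k" by (intro eq_matI) auto
      finally show ?thesis by simp
    qed
  qed
  have "poly d a \<noteq> 0" for a
  proof
    assume root: "poly d a = 0"
    obtain V where V: "V \<in> carrier_mat k k" "W = [:-a, 1:] \<cdot>\<^sub>m V"
      by (rule divide_out_root[OF W W_root[OF root]])
    obtain e where e: "d = [:-a, 1:] * e" using root by (auto simp: poly_eq_0_iff_dvd elim: dvdE)
    have "A * V = e \<cdot>\<^sub>m B"
    proof (intro eq_matI)
      fix i j assume "i < dim_row (e \<cdot>\<^sub>m B)" "j < dim_col (e \<cdot>\<^sub>m B)"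
      then have ij: "i < m" "j < k" using B by auto
      have "[:-a, 1:] \<cdot>\<^sub>m (A * V) = d \<cdot>\<^sub>m B"
        unfolding AW[symmetric] V(2) by (rule mult_smult_distrib[OF A V(1), symmetric])
      then have "([:-a, 1:] \<cdot>\<^sub>m (A * V)) $$ (i, j) = (d \<cdot>\<^sub>m B) $$ (i, j)" by simp
      then have "[:-a, 1:] * (A * V) $$ (i, j) = [:-a, 1:] * (e * B $$ (i, j))"
        using ij A B V(1) unfolding e by (simp only: index_smult_mat mult.assoc carrier_matD index_mult_mat)
      then have "(A * V) $$ (i, j) = e * B $$ (i, j)" by (subst (asm) mult_cancel_left) auto
      then show "(A * V) $$ (i, j) = (e \<cdot>\<^sub>m B) $$ (i, j)" using ij B by simp
    qed (use A B V in auto)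
    moreover have "e \<noteq> 0" using d e by auto
    ultimately have "T (e, V)" unfolding T_def using V(1) by simp
    then have "degree d \<le> degree e" using x(2)[of "(e, V)"] dW by simp
    moreover have "degree d = Suc (degree e)"
      unfolding e using \<open>e \<noteq> 0\<close> by (subst degree_mult_eq) auto
    ultimately show False by simp
  qed
  then have "degree d = 0"
    using fundamental_theorem_of_algebra[of d] constant_degree[of d] by blast
  then obtain c where c: "d = [:c:]" by (rule degree_eq_zeroE)
  then have c0: "c \<noteq> 0" using d by auto
  have const: "?W z = ?W 0" for z
  proof (rule const_mat_if_adjoint_bounded_at_0[OF A B W liB])
    show "?B z * mat_adjoint (?W (?r z)) = cnj c \<cdot>\<^sub>m ?A z" if "z \<noteq> 0" for z
      using BW[OF that] by (simp add: c)
  qed simp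
  let ?U = "(1 / c) \<cdot>\<^sub>m ?W 0"
  have U: "?U \<in> carrier_mat k k" using Wc by simp
  have "?B z = ?A z * ?U" for z
  proof -
    have "?A z * ?U = (1 / c) \<cdot>\<^sub>m (?A z * ?W z)"
      unfolding const[of z] by (rule mult_smult_distrib[OF Ac Wc])
    also have "\<dots> = ?B z" unfolding AWz using c0 by (auto simp: c intro!: eq_matI)
    finally show ?thesis by simp
  qed
  moreover have UU: "?U * mat_adjoint ?U = 1\<^sub>m k"
  proof -
    have aW: "mat_adjoint (?W 0) \<in> carrier_mat k k" using Wc by simp
    have "?W 1 * mat_adjoint (?W (?r 1)) = (c * cnj c) \<cdot>\<^sub>m 1\<^sub>m k" using WW[of 1] by (simp add: c)
    then have W0: "?W 0 * mat_adjoint (?W 0) = (c * cnj c) \<cdot>\<^sub>m 1\<^sub>m k" unfolding const[of 1] const[of "?r 1"] .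
    have "?U * mat_adjoint ?U = (1 / c) \<cdot>\<^sub>m (cnj (1 / c) \<cdot>\<^sub>m (?W 0 * mat_adjoint (?W 0)))"
      unfolding mat_adjoint_smult mult_smult_assoc_mat[OF Wc smult_carrier_mat[OF aW]] mult_smult_distrib[OF Wc aW] ..
    also have "\<dots> = 1\<^sub>m k" unfolding W0 using c0 by (auto intro!: eq_matI)
    finally show ?thesis .
  qed
  moreover have "mat_adjoint ?U * ?U = 1\<^sub>m k"
    by (rule mat_mult_left_right_inverse[OF U _ UU]) (use Wc in simp)
  ultimately show ?thesis unfolding unitary_mat_def using U by blast
qed

section \<open>The spectral factorization\<close>

lemma AE_cis_not_in_finite:
  assumes E: "finite E"
  shows "AE t in lebesgue_on {0..2 * pi}. cis t \<notin> E"
proof -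
  define T where "T = {t \<in> {0..2 * pi}. cis t \<in> E}"
  have inj: "inj_on cis {0..<2 * pi}"
  proof (rule inj_onI)
    fix x y assume xy: "x \<in> {0..<2 * pi}" "y \<in> {0..<2 * pi}" "cis x = cis y"
    then have "sin x = sin y \<and> cos x = cos y" by (simp add: complex_eq_iff)
    then obtain n :: int where n: "x = y + 2 * pi * n" using sin_cos_eq_iff by auto
    moreover have "\<bar>x - y\<bar> < 2 * pi" using xy(1,2) by (simp add: abs_less_iff)
    ultimately have "2 * pi * \<bar>real_of_int n\<bar> < 2 * pi * 1" by (simp add: abs_mult)
    then have "\<bar>real_of_int n\<bar> < 1" by (subst (asm) mult_less_cancel_left_pos) auto
    then have "n = 0" by linarith
    then show "x = y" using n by simp
  qed
  have "finite (T \<inter> {0..<2 * pi})"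
    by (rule finite_imageD[OF finite_subset[OF _ E]]) (auto simp: T_def intro: inj_on_subset[OF inj])
  moreover have "T \<subseteq> insert (2 * pi) (T \<inter> {0..<2 * pi})" by (auto simp: T_def)
  ultimately have "finite T" by (metis finite_insert finite_subset)
  then have "T \<in> null_sets lebesgue" using negligible_iff_null_sets by blast
  then have "T \<in> null_sets (lebesgue_on {0..2 * pi})"
    by (subst null_sets_restrict_space) (auto simp: T_def)
  from AE_not_in[OF this] show ?thesis
    using AE_space by eventually_elim (auto simp: T_def)
qed

lemma nonneg_definite_imp_psd_on:
  assumes "nonneg_definite m M"
  shows "psd_on {..<m} (\<lambda>i j. M $$ (i, j))"
  unfolding psd_on_def
proof
  fix x :: "nat \<Rightarrow> complex"
  have M: "M \<in> carrier_mat m m" using assms by (simp add: nonneg_definite_def)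
  have "0 \<le> (M *\<^sub>v vec m x) \<bullet>c vec m x"
    using assms vec_carrier[of m x] unfolding nonneg_definite_def by blast
  also have "(M *\<^sub>v vec m x) \<bullet>c vec m x = (\<Sum>i<m. \<Sum>j<m. cnj (x i) * M $$ (i, j) * x j)"
    using M by (simp add: scalar_prod_def atLeast0LessThan sum_distrib_left mult_ac)
  finally show "0 \<le> (\<Sum>i<m. \<Sum>j<m. cnj (x i) * M $$ (i, j) * x j)" .
qed

lemma mat_poly_plus_carrier [simp]: "mat_poly_plus m k N A z \<in> carrier_mat m k"
  by (simp add: mat_poly_plus_def mat_sum_def)

lemma mat_poly_plus_dim [simp]:
  "dim_row (mat_poly_plus m k N A z) = m" "dim_col (mat_poly_plus m k N A z) = k"
  by (simp_all add: mat_poly_plus_def mat_sum_def)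

lemma mat_poly_plus_index:
  assumes "\<forall>n\<in>{0..N}. A n \<in> carrier_mat m k" "i < m" "l < k"
  shows "mat_poly_plus m k N A z $$ (i, l) = (\<Sum>n\<le>N. A n $$ (i, l) * z ^ n)"
proof -
  have "mat_poly_plus m k N A z $$ (i, l) = (\<Sum>n\<in>{0..N}. (z ^ n \<cdot>\<^sub>m A n) $$ (i, l))"
    using assms by (simp add: mat_poly_plus_def mat_sum_def)
  also have "\<dots> = (\<Sum>n\<in>{0..N}. A n $$ (i, l) * z ^ n)"
  proof (rule sum.cong[OF refl])
    fix n assume "n \<in> {0..N}"
    then have "A n \<in> carrier_mat m k" using assms by blast
    then show "(z ^ n \<cdot>\<^sub>m A n) $$ (i, l) = A n $$ (i, l) * z ^ n" using assms by simp
  qed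
  finally show ?thesis by (simp add: atLeast0AtMost)
qed

lemma trig_mat_poly_index:
  assumes "\<forall>n\<in>{- int N..int N}. C n \<in> carrier_mat m m" "i < m" "j < m"
  shows "trig_mat_poly m N C z $$ (i, j) = (\<Sum>d\<in>{- int N..int N}. z powi d * C d $$ (i, j))"
  using assms unfolding trig_mat_poly_def mat_sum_def by (auto intro!: sum.cong)

lemma mat_poly_minus_eq_adjoint:
  assumes A: "\<forall>n\<in>{0..N}. A n \<in> carrier_mat m k" and z: "z \<noteq> 0"
  shows "mat_poly_minus m k N A z = mat_adjoint (mat_poly_plus m k N A (1 / cnj z))"
proof (intro eq_matI)
  fix l i assume "l < dim_row (mat_adjoint (mat_poly_plus m k N A (1 / cnj z)))"
    "i < dim_col (mat_adjoint (mat_poly_plus m k N A (1 / cnj z)))"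
  then have li: "l < k" "i < m" using mat_poly_plus_carrier by (simp_all add: mat_poly_plus_def mat_sum_def)
  have "mat_poly_minus m k N A z $$ (l, i) = (\<Sum>n\<le>N. z powi (- int n) * cnj (A n $$ (i, l)))"
    unfolding mat_poly_minus_def mat_sum_def atLeast0AtMost
  proof (subst index_mat)
    show "l < k" "i < m" by fact+
    show "(\<lambda>(l, i). \<Sum>n\<le>N. (z powi (- int n) \<cdot>\<^sub>m mat_adjoint (A n)) $$ (l, i)) (l, i)
        = (\<Sum>n\<le>N. z powi (- int n) * cnj (A n $$ (i, l)))"
      unfolding prod.case
    proof (rule sum.cong[OF refl])
      fix n assume "n \<in> {..N}"
      then have "A n \<in> carrier_mat m k" using A by simp
      then show "(z powi (- int n) \<cdot>\<^sub>m mat_adjoint (A n)) $$ (l, i) = z powi (- int n) * cnj (A n $$ (i, l))"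
        using li by simp
    qed
  qed
  also have "\<dots> = (\<Sum>n\<le>N. cnj (A n $$ (i, l)) * (1 / z) ^ n)"
    by (intro sum.cong refl) (simp add: power_int_minus power_divide divide_inverse power_inverse mult.commute)
  also have "\<dots> = cnj (mat_poly_plus m k N A (1 / cnj z) $$ (i, l))"
    using mat_poly_plus_index[OF A li(2,1)] by simp
  also have "\<dots> = mat_adjoint (mat_poly_plus m k N A (1 / cnj z)) $$ (l, i)"
    by (rule mat_adjoint_index[symmetric]) (simp_all add: li mat_poly_plus_def mat_sum_def)
  finally show "mat_poly_minus m k N A z $$ (l, i) = mat_adjoint (mat_poly_plus m k N A (1 / cnj z)) $$ (l, i)" .
qed (use mat_poly_plus_carrier in \<open>simp_all add: mat_poly_minus_def mat_poly_plus_def mat_sum_def\<close>)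

definition coeff_poly_mat :: "nat \<Rightarrow> nat \<Rightarrow> nat \<Rightarrow> (nat \<Rightarrow> complex mat) \<Rightarrow> complex poly mat" where
  "coeff_poly_mat m k N A = mat m k (\<lambda>(i, j). \<Sum>n\<le>N. monom (A n $$ (i, j)) n)"

lemma coeff_poly_mat_carrier [simp]: "coeff_poly_mat m k N A \<in> carrier_mat m k"
  by (simp add: coeff_poly_mat_def)

lemma eval_coeff_poly_mat:
  assumes "\<forall>n\<in>{0..N}. A n \<in> carrier_mat m k"
  shows "eval_mat (coeff_poly_mat m k N A) z = mat_poly_plus m k N A z"
proof (intro eq_matI)
  fix i j assume "i < dim_row (mat_poly_plus m k N A z)" "j < dim_col (mat_poly_plus m k N A z)"
  then have ij: "i < m" "j < k" by (auto simp: mat_poly_plus_def mat_sum_def)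
  show "eval_mat (coeff_poly_mat m k N A) z $$ (i, j) = mat_poly_plus m k N A z $$ (i, j)"
    unfolding mat_poly_plus_index[OF assms ij] using ij by (simp add: coeff_poly_mat_def poly_sum poly_monom)
qed (auto simp: mat_poly_plus_def mat_sum_def coeff_poly_mat_def)

lemma spectral_factor_unique:
  assumes "spectral_factor m k N C A" "spectral_factor m k N C B"
  shows "\<exists>U. unitary_mat k U \<and> (\<forall>z. mat_poly_plus m k N B z = mat_poly_plus m k N A z * U)"
proof -
  have cA: "\<forall>n\<in>{0..N}. A n \<in> carrier_mat m k" and cB: "\<forall>n\<in>{0..N}. B n \<in> carrier_mat m k"
    using assms by (auto simp: spectral_factor_def)
  note ev = eval_coeff_poly_mat[OF cA] eval_coeff_poly_mat[OF cB]
  have "\<exists>U. unitary_mat k U \<and> (\<forall>z. eval_mat (coeff_poly_mat m k N B) z = eval_mat (coeff_poly_mat m k N A) z * U)"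
  proof (rule unitary_transition[OF coeff_poly_mat_carrier coeff_poly_mat_carrier])
    fix z :: complex assume "cmod z < 1"
    then show "left_invertible (eval_mat (coeff_poly_mat m k N A) z)"
      "left_invertible (eval_mat (coeff_poly_mat m k N B) z)"
      using assms unfolding ev mat_rank_eq_ncols_iff[OF mat_poly_plus_carrier, symmetric] spectral_factor_def by auto
  next
    fix z :: complex assume z: "z \<noteq> 0"
    show "eval_mat (coeff_poly_mat m k N A) z * mat_adjoint (eval_mat (coeff_poly_mat m k N A) (1 / cnj z))
        = eval_mat (coeff_poly_mat m k N B) z * mat_adjoint (eval_mat (coeff_poly_mat m k N B) (1 / cnj z))"
      unfolding ev mat_poly_minus_eq_adjoint[OF cA z, symmetric] mat_poly_minus_eq_adjoint[OF cB z, symmetric]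
      using assms z unfolding spectral_factor_def by metis
  qed
  then show ?thesis unfolding ev .
qed

text \<open>
  The factor belongs to an extremal Gram matrix; its number of columns \<open>r\<close> is the rank of that matrix and
  is compared with the rank of the trigonometric polynomial only afterwards.
\<close>

lemma ex_analytic_factor:
  fixes C :: "int \<Rightarrow> complex mat"
  assumes C: "\<forall>n\<in>{- int N..int N}. C n \<in> carrier_mat m m"
    and nonneg: "AE t in lebesgue_on {0..2 * pi}. nonneg_definite m (trig_mat_poly m N C (cis t))"
  shows "\<exists>r A. (\<forall>n\<in>{0..N}. A n \<in> carrier_mat m r) \<and>
     (\<forall>z. cmod z < 1 \<longrightarrow> left_invertible (mat_poly_plus m r N A z)) \<and>
     (\<forall>z. z \<noteq> 0 \<longrightarrow> trig_mat_poly m N C z = mat_poly_plus m r N A z * mat_poly_minus m r N A z) \<and>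
     (A N = 0\<^sub>m m r \<longrightarrow> C (int N) = 0\<^sub>m m m)"
proof -
  define c where "c d i j = (if \<bar>d\<bar> \<le> int N then C d $$ (i, j) else 0)" for d i j
  have "AE t in lebesgue_on {0..2 * pi}. psd_on {..<m} (\<lambda>i j. \<Sum>d\<in>{- int N..int N}. c d i j * cis (of_int d * t))"
    using nonneg
  proof eventually_elim
    fix t assume "nonneg_definite m (trig_mat_poly m N C (cis t))"
    from nonneg_definite_imp_psd_on[OF this]
    show "psd_on {..<m} (\<lambda>i j. \<Sum>d\<in>{- int N..int N}. c d i j * cis (of_int d * t))"
    proof (rule psd_on_cong)
      fix i j assume "i \<in> {..<m}" "j \<in> {..<m}"
      then have "i < m" "j < m" by auto
      then show "(\<Sum>d\<in>{- int N..int N}. c d i j * cis (of_int d * t)) = trig_mat_poly m N C (cis t) $$ (i, j)"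
        unfolding trig_mat_poly_index[OF C \<open>i < m\<close> \<open>j < m\<close>]
        by (intro sum.cong refl) (auto simp: c_def cis_power_int)
    qed
  qed
  then have "psd_on ({..<n} \<times> {..<m}) (\<lambda>p q. c (int (fst p) - int (fst q)) (snd p) (snd q))" for n
    by (rule psd_on_Toeplitz) (simp add: c_def)
  then have "gram_set N m c \<noteq> {}"
    by (intro gram_set_nonempty) (auto simp: c_def)
  then obtain G where G: "G \<in> gram_set N m c"
    and max: "\<And>H. H \<in> gram_set N m c \<Longrightarrow> (\<Sum>i<m. Re (H (0, i) (0, i))) \<le> (\<Sum>i<m. Re (G (0, i) (0, i)))"
    by (rule ex_extremal_gram) blast
  let ?J = "block_index N m"
  have finJ: "finite ?J" and psdG: "psd_on ?J G" using G by (auto simp: gram_set_def)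
  obtain P F where P: "P \<subseteq> ?J"
    and F: "\<And>p q. p \<in> ?J \<Longrightarrow> q \<in> ?J \<Longrightarrow> G p q = (\<Sum>r\<in>P. F r p * cnj (F r q))"
    and indep: "\<forall>u. (\<forall>p\<in>?J. (\<Sum>r\<in>P. u r * F r p) = 0) \<longrightarrow> (\<forall>r\<in>P. u r = 0)"
    by (rule psd_on_Cholesky[of ?J G "\<lambda>_. 0" 0, OF finJ psdG]) (simp, rule that)
  have finP: "finite P" using P finJ finite_subset by blast
  define r where "r = card P"
  obtain f where f: "bij_betw f {..<r} P"
    using ex_bij_betw_nat_finite[OF finP] by (auto simp: r_def atLeast0LessThan)
  define A where "A n = mat m r (\<lambda>(i, l). F (f l) (n, i))" for n
  have cA: "\<forall>n\<in>{0..N}. A n \<in> carrier_mat m r" by (simp add: A_def)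
  have plus: "mat_poly_plus m r N A z $$ (i, l) = (\<Sum>s\<le>N. F (f l) (s, i) * z ^ s)" if "i < m" "l < r" for z i l
    using that unfolding mat_poly_plus_index[OF cA that] by (simp add: A_def)
  have "left_invertible (mat_poly_plus m r N A z)" if z: "cmod z < 1" for z
    unfolding left_invertible_iff_injective[OF mat_poly_plus_carrier]
  proof (intro ballI impI)
    fix v assume v: "v \<in> carrier_vec r" "mat_poly_plus m r N A z *\<^sub>v v = 0\<^sub>v m"
    define u where "u p = v $ (inv_into {..<r} f p)" for p
    have uf: "u (f l) = v $ l" if "l < r" for l
      using bij_betw_inv_into_left[OF f, of l] that by (simp add: u_def)
    have sum_u: "(\<Sum>p\<in>P. u p * F p q) = (\<Sum>l<r. v $ l * F (f l) q)" for q
      unfolding sum.reindex_bij_betw[OF f, symmetric] by (intro sum.cong refl) (simp add: uf)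
    have root: "(\<Sum>s\<le>N. (\<Sum>p\<in>P. u p * F p (s, i)) * z ^ s) = 0" if i: "i < m" for i
    proof -
      have "0 = (mat_poly_plus m r N A z *\<^sub>v v) $ i" using v i by simp
      also have "\<dots> = (\<Sum>l<r. (\<Sum>s\<le>N. F (f l) (s, i) * z ^ s) * v $ l)"
        using v(1) i by (simp add: scalar_prod_def plus atLeast0LessThan)
      also have "\<dots> = (\<Sum>s\<le>N. (\<Sum>p\<in>P. u p * F p (s, i)) * z ^ s)"
        unfolding sum_u sum_distrib_right by (subst sum.swap) (simp add: mult_ac)
      finally show ?thesis by simp
    qed
    have u0: "u p = 0" if "p \<in> P" for p
      using G max F finP indep z root that by (rule extremal_gram_factor_injective)
    have "v $ l = 0" if "l < r" for l
      using uf[OF that] u0[of "f l"] bij_betwE[OF f] that by simp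
    then show "v = 0\<^sub>v r" using v(1) by (intro eq_vecI) auto
  qed
  moreover have "trig_mat_poly m N C z = mat_poly_plus m r N A z * mat_poly_minus m r N A z" if z: "z \<noteq> 0" for z
  proof (intro eq_matI)
    fix i j assume "i < dim_row (mat_poly_plus m r N A z * mat_poly_minus m r N A z)"
      "j < dim_col (mat_poly_plus m r N A z * mat_poly_minus m r N A z)"
    then have ij: "i < m" "j < m" by (auto simp: mat_poly_plus_def mat_poly_minus_def mat_sum_def)
    have "trig_mat_poly m N C z $$ (i, j) = (\<Sum>d\<in>{- int N..int N}. z powi d * diag_sum N G d i j)"
      unfolding trig_mat_poly_index[OF C ij] using G ij by (intro sum.cong refl) (auto simp: gram_set_def c_def)
    also have "\<dots> = (\<Sum>d\<in>{- int N..int N}. \<Sum>s\<le>N. \<Sum>t\<le>N.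
        if d = int s - int t then z powi (int s - int t) * G (s, i) (t, j) else 0)"
      unfolding diag_sum_def sum_distrib_left by (intro sum.cong refl) auto
    also have "\<dots> = (\<Sum>s\<le>N. \<Sum>d\<in>{- int N..int N}. \<Sum>t\<le>N.
        if d = int s - int t then z powi (int s - int t) * G (s, i) (t, j) else 0)"
      by (rule sum.swap)
    also have "\<dots> = (\<Sum>s\<le>N. \<Sum>t\<le>N. \<Sum>d\<in>{- int N..int N}.
        if d = int s - int t then z powi (int s - int t) * G (s, i) (t, j) else 0)"
      by (intro sum.cong[OF refl] sum.swap)
    also have "\<dots> = (\<Sum>s\<le>N. \<Sum>t\<le>N. z powi (int s - int t) * G (s, i) (t, j))"
      by (intro sum.cong refl) (auto simp: sum.delta)
    also have "\<dots> = (\<Sum>s\<le>N. \<Sum>t\<le>N. \<Sum>l<r. (F (f l) (s, i) * z ^ s) * cnj (F (f l) (t, j) * (1 / cnj z) ^ t))"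
    proof (intro sum.cong refl)
      fix s t assume st: "s \<in> {..N}" "t \<in> {..N}"
      have "G (s, i) (t, j) = (\<Sum>l<r. F (f l) (s, i) * cnj (F (f l) (t, j)))"
        using F[of "(s, i)" "(t, j)"] st ij sum.reindex_bij_betw[OF f, symmetric] by simp
      moreover have "z powi (int s - int t) = z ^ s * cnj ((1 / cnj z) ^ t)"
        using z by (simp add: power_int_diff power_divide)
      ultimately show "z powi (int s - int t) * G (s, i) (t, j)
          = (\<Sum>l<r. (F (f l) (s, i) * z ^ s) * cnj (F (f l) (t, j) * (1 / cnj z) ^ t))"
        by (simp add: sum_distrib_left mult_ac)
    qed
    also have "\<dots> = (\<Sum>l<r. \<Sum>s\<le>N. \<Sum>t\<le>N. (F (f l) (s, i) * z ^ s) * cnj (F (f l) (t, j) * (1 / cnj z) ^ t))"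
      by (simp only: sum.swap[of _ "{..<r}" "{..N}"])
    also have "\<dots> = (\<Sum>l<r. mat_poly_plus m r N A z $$ (i, l) * cnj (mat_poly_plus m r N A (1 / cnj z) $$ (j, l)))"
      using ij by (simp add: plus sum_product)
    also have "\<dots> = (mat_poly_plus m r N A z * mat_poly_minus m r N A z) $$ (i, j)"
      unfolding mat_poly_minus_eq_adjoint[OF cA z]
      using ij mat_poly_plus_carrier[of m r N A z] mat_poly_plus_carrier[of m r N A "1 / cnj z"]
      by (simp add: scalar_prod_def atLeast0LessThan)
    finally show "trig_mat_poly m N C z $$ (i, j) = (mat_poly_plus m r N A z * mat_poly_minus m r N A z) $$ (i, j)" .
  qed (auto simp: trig_mat_poly_def mat_poly_plus_def mat_poly_minus_def mat_sum_def)
  moreover have "C (int N) = 0\<^sub>m m m" if AN: "A N = 0\<^sub>m m r"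
  proof (intro eq_matI)
    fix i j assume "i < dim_row (0\<^sub>m m m :: complex mat)" "j < dim_col (0\<^sub>m m m :: complex mat)"
    then have ij: "i < m" "j < m" by auto
    have "F (f l) (N, i) = 0" if "l < r" for l
      using arg_cong[OF AN, of "\<lambda>M. M $$ (i, l)"] that ij by (simp add: A_def)
    then have "F p (N, i) = 0" if "p \<in> P" for p
      using f that by (auto simp: bij_betw_def)
    then have GN: "G (N, i) (t, j) = 0" if "t \<le> N" for t
      using F[of "(N, i)" "(t, j)"] that ij by simp
    have "diag_sum N G (int N) i j = 0"
      unfolding diag_sum_def
    proof (intro sum.neutral ballI)
      fix s t assume "s \<in> {..N}" "t \<in> {..N}"
      then have "s = N" if "int s - int t = int N" using that by auto
      then show "(if int s - int t = int N then G (s, i) (t, j) else 0) = 0"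
        using GN \<open>t \<in> {..N}\<close> by auto
    qed
    then have "c (int N) i j = 0" using G ij by (simp add: gram_set_def)
    then show "C (int N) $$ (i, j) = 0\<^sub>m m m $$ (i, j)" using ij by (simp add: c_def)
  qed (use C in auto)
  ultimately show ?thesis using cA by blast
qed

theorem theorem1:
  fixes m k N :: nat and C :: "int \<Rightarrow> complex mat"
  assumes "m \<ge> 1" and "k \<le> m"
    and "\<forall>n\<in>{- int N..int N}. C n \<in> carrier_mat m m"
    and "C (int N) = mat_adjoint (C (- int N))" and "C (int N) \<noteq> 0\<^sub>m m m"
    and "AE t in lebesgue_on {0..2 * pi}.
           nonneg_definite m (trig_mat_poly m N C (cis t)) \<and>
           mat_rank m (trig_mat_poly m N C (cis t)) = k"
  shows "\<exists>A. spectral_factor m k N C A \<and>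
           (\<forall>B. spectral_factor m k N C B \<longrightarrow>
              (\<exists>U. unitary_mat k U \<and>
                 (\<forall>z. mat_poly_plus m k N B z = mat_poly_plus m k N A z * U)))"
proof -
  have nonneg: "AE t in lebesgue_on {0..2 * pi}. nonneg_definite m (trig_mat_poly m N C (cis t))"
    and rank: "AE t in lebesgue_on {0..2 * pi}. mat_rank m (trig_mat_poly m N C (cis t)) = k"
    using assms(6) by (auto elim: eventually_mono)
  obtain r A where A: "\<forall>n\<in>{0..N}. A n \<in> carrier_mat m r"
    and inj: "\<forall>z. cmod z < 1 \<longrightarrow> left_invertible (mat_poly_plus m r N A z)"
    and fac: "\<forall>z. z \<noteq> 0 \<longrightarrow> trig_mat_poly m N C z = mat_poly_plus m r N A z * mat_poly_minus m r N A z"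
    and top: "A N = 0\<^sub>m m r \<longrightarrow> C (int N) = 0\<^sub>m m m"
    using ex_analytic_factor[OF assms(3) nonneg] by blast
  have "finite {z. \<not> left_invertible (mat_poly_plus m r N A z)}"
    using finite_not_left_invertible[of "coeff_poly_mat m r N A" m r 0] inj
    by (simp add: eval_coeff_poly_mat[OF A])
  \<comment> \<open>a point of the circle at which the factor is injective and the rank is \<open>k\<close>\<close>
  from AE_cis_not_in_finite[OF this] rank
  have "AE t in lebesgue_on {0..2 * pi}. left_invertible (mat_poly_plus m r N A (cis t)) \<and>
      mat_rank m (trig_mat_poly m N C (cis t)) = k"
    by eventually_elim simp
  moreover have "ae_filter (lebesgue_on {0..2 * pi}) \<noteq> bot"
    by (simp add: ae_filter_eq_bot_iff emeasure_restrict_space)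
  ultimately obtain t where t: "left_invertible (mat_poly_plus m r N A (cis t))"
      "mat_rank m (trig_mat_poly m N C (cis t)) = k"
    using eventually_happens' by blast
  have "trig_mat_poly m N C (cis t) = mat_poly_plus m r N A (cis t) * mat_adjoint (mat_poly_plus m r N A (cis t))"
    using fac mat_poly_minus_eq_adjoint[OF A cis_neq_zero[of t]] by (simp add: cis_cnj cis_divide[of 0, simplified])
  then have "r = k" using mat_rank_mult_adjoint[OF mat_poly_plus_carrier t(1)] t(2) by simp
  then have "spectral_factor m k N C A"
    using A inj fac top assms(5) unfolding spectral_factor_def mat_rank_eq_ncols_iff[OF mat_poly_plus_carrier] by blast
  then show ?thesis using spectral_factor_unique by blast
qed

end
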